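(* Let $\delta$ be any closed trajectory in a triangle tiling billiard. Then the minimal period of its symbolic coding $\omega(\delta)$ has odd length. Consequently, the period of $\delta$ is equal to $4n+2$ for some integer $n\ge 1$.
   Context: Triangle tiling billiard: given a triangle $\Delta$, the plane is tiled by triangles congruent to $\Delta$, obtained by cutting the plane by three families of equidistant parallel lines (neighbouring tiles are images of each other under the central symmetry in the midpoint of their common side). A particle moves along a straight segment inside a tile; when it hits a side, it continues in the neighbouring tile so that the oriented angle with the side changes sign but keeps its absolute value (refraction coefficient $-1$). A trajectory is a full two-sided path of this kind that does not hit vertices of the tiling. It is closed if it is a closed curve in the plane; its period is the number of sides crossed along one traversal. The sides of $\Delta$ are labelled $a,b,c$ (and correspondingly for all tiles); the symbolic coding $\omega(\delta)$ is the bi-infinite word in $\{a,b,c\}$ of labels of the successively crossed sides. For a closed trajectory it is a periodic word $\overline{s}=\dots sss\dots$; the minimal period is the shortest such $s$. *)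

theory Defs
  imports "HOL-Analysis.Analysis"
begin

datatype side = A | B | C

text \<open>
  A triangle with labelled sides is given by its vertices: \<open>T l\<close> is the vertex opposite to
  the side labelled \<open>l\<close>.
\<close>

type_synonym triangle = "side \<Rightarrow> complex"

fun side_ends :: "triangle \<Rightarrow> side \<Rightarrow> complex \<times> complex" where
  "side_ends T A = (T B, T C)"
| "side_ends T B = (T C, T A)"
| "side_ends T C = (T A, T B)"

definition tile_interior :: "triangle \<Rightarrow> complex set" where
  "tile_interior T = interior (convex hull (range T))"

definition open_side :: "triangle \<Rightarrow> side \<Rightarrow> complex set" where
  "open_side T l = open_segment (fst (side_ends T l)) (snd (side_ends T l))"

definition side_vector :: "triangle \<Rightarrow> side \<Rightarrow> complex" where
  "side_vector T l = snd (side_ends T l) - fst (side_ends T l)"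

definition central_symmetry :: "complex \<Rightarrow> complex \<Rightarrow> complex" where
  "central_symmetry m z = 2 *\<^sub>R m - z"

text \<open>
  The image of \<open>T\<close> under the central symmetry in the midpoint of its side \<open>l\<close>. Each vertex
  keeps its label, so each side has the label of its preimage; the common side, which is
  mapped to itself, has label \<open>l\<close> in both tiles.
\<close>

definition neighbour :: "triangle \<Rightarrow> side \<Rightarrow> triangle" where
  "neighbour T l = (\<lambda>k. central_symmetry (midpoint (fst (side_ends T l)) (snd (side_ends T l))) (T k))"

text \<open>
  These are exactly the triangles cut out by the three families of lines parallel to the
  sides of \<open>\<Delta>\<close> at which one of the barycentric coordinates with respect to \<open>\<Delta>\<close> is an
  integer; the label of a side is the family that contains it.
\<close>

inductive_set tiling :: "triangle \<Rightarrow> triangle set" for \<Delta> :: triangle where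
  base: "\<Delta> \<in> tiling \<Delta>"
| neighbour: "T \<in> tiling \<Delta> \<Longrightarrow> neighbour T l \<in> tiling \<Delta>"

text \<open>
  Refraction with coefficient \<open>-1\<close> at a line of direction \<open>e\<close>: the component of the velocity
  \<open>u\<close> along \<open>e\<close> changes sign and the normal component is kept. The particle thus passes to
  the other side of the line, and the oriented angle of its path with the line changes sign.
\<close>

definition refract :: "complex \<Rightarrow> complex \<Rightarrow> complex" where
  "refract e u = u - (2 * (u \<bullet> e) / (e \<bullet> e)) *\<^sub>R e"

text \<open>
  A trajectory is a two-sided broken line. Its \<open>i\<close>-th segment runs inside \<open>tile \<delta> i\<close> from the
  crossing point \<open>point \<delta> i\<close> to the crossing point \<open>point \<delta> (i + 1)\<close>, and \<open>coding \<delta> i\<close> is the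
  label of the side crossed at \<open>point \<delta> i\<close>.
\<close>

record path =
  point :: "int \<Rightarrow> complex"
  tile :: "int \<Rightarrow> triangle"
  coding :: "int \<Rightarrow> side"

definition direction :: "path \<Rightarrow> int \<Rightarrow> complex" where
  "direction \<delta> i = sgn (point \<delta> (i + 1) - point \<delta> i)"

text \<open>
  Crossing points lie on open sides, so that no vertex of the tiling is hit.
\<close>

definition trajectory :: "triangle \<Rightarrow> path \<Rightarrow> bool" where
  "trajectory \<Delta> \<delta> \<longleftrightarrow>
    (\<forall>i. tile \<delta> i \<in> tiling \<Delta> \<and>
         point \<delta> i \<noteq> point \<delta> (i + 1) \<and>
         open_segment (point \<delta> i) (point \<delta> (i + 1)) \<subseteq> tile_interior (tile \<delta> i) \<and>
         point \<delta> i \<in> open_side (tile \<delta> i) (coding \<delta> i) \<and>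
         point \<delta> (i + 1) \<in> open_side (tile \<delta> i) (coding \<delta> (i + 1)) \<and>
         tile \<delta> (i + 1) = neighbour (tile \<delta> i) (coding \<delta> (i + 1)) \<and>
         direction \<delta> (i + 1) =
           refract (side_vector (tile \<delta> i) (coding \<delta> (i + 1))) (direction \<delta> i))"

definition closes_after :: "path \<Rightarrow> nat \<Rightarrow> bool" where
  "closes_after \<delta> N \<longleftrightarrow> N > 0 \<and> (\<forall>i. point \<delta> (i + int N) = point \<delta> i)"

definition closed_trajectory :: "path \<Rightarrow> bool" where
  "closed_trajectory \<delta> \<longleftrightarrow> (\<exists>N. closes_after \<delta> N)"

definition period :: "path \<Rightarrow> nat" where
  "period \<delta> = (LEAST N. closes_after \<delta> N)"

definition periodic_word :: "'a list \<Rightarrow> int \<Rightarrow> 'a" where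
  "periodic_word s i = s ! nat (i mod int (length s))"

definition minimal_period :: "(int \<Rightarrow> 'a) \<Rightarrow> 'a list" where
  "minimal_period w = (ARG_MIN length s. s \<noteq> [] \<and> w = periodic_word s)"

end

theory Submission
  imports Defs
begin

text \<open>
  Folding the plane along all sides turns every tile into a triangle inscribed in the
  circumcircle of \<open>\<Delta>\<close>, neighbours being reflected in the bisector of their common chord. On
  the vertex lattice the folding is a character with values in the circle, and because the
  refraction coefficient is \<open>-1\<close>, the folded trajectory stays on one chord. So the trajectory is a
  level curve of a function that is affine on every tile, and it separates lattice vertices whose
  images lie on either of the two arcs cut off by the chord.

  Suppose the curve is closed. Then it bounds a finite set of vertices, and the vertices on its
  inner side belong to a finite connected component \<open>K\<close> of the vertices lying over one open
  arc. Let \<open>a\<close>, \<open>b\<close> be elements of \<open>K\<close> whose images are extremal in that arc. The central symmetry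
  \<open>v \<mapsto> a + b - v\<close> acts on the circle as the reflection exchanging the two extremal points, so it
  preserves the vertices over the arc between them; as it exchanges \<open>a\<close> and \<open>b\<close>, it maps \<open>K\<close> to itself.
  Hence it preserves the region enclosed by the curve, and therefore the curve.
  It preserves labels and exchanges the two orientations of tiles, which alternate along
  the curve: the coding has an odd period \<open>j\<close>. If \<open>m\<close> is the minimal period of the coding,
  passing \<open>m\<close> sides is again a central symmetry, so the curve closes after exactly \<open>2m\<close> sides.
\<close>

section \<open>The triangular lattice and its cells\<close>

fun nxt :: "side \<Rightarrow> side" where "nxt A = B" | "nxt B = C" | "nxt C = A"
fun prv :: "side \<Rightarrow> side" where "prv A = C" | "prv B = A" | "prv C = B"

lemma side_ends_nxt_prv: "side_ends T l = (T (nxt l), T (prv l))"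
  by (cases l) auto

lemma nxt_prv_distinct [simp]:
  "nxt l \<noteq> l" "prv l \<noteq> l" "nxt l \<noteq> prv l" "l \<noteq> nxt l" "l \<noteq> prv l" "prv l \<noteq> nxt l"
  by (cases l; simp)+

lemma side_cases3:
  fixes l :: side
  assumes "P l" "P (nxt l)" "P (prv l)"
  shows "P k"
  using assms by (cases l; cases k) auto

type_synonym vertex = "int \<times> int"

text \<open>
  The vertex \<open>(x, y)\<close> is the lattice point with barycentric coordinates \<open>(x, y, 1 - x - y)\<close> with
  respect to \<open>\<Delta>\<close>. The cell \<open>(s, z)\<close> is a translate of \<open>\<Delta>\<close> if \<open>s\<close> holds and of \<open>- \<Delta>\<close> otherwise,
  with its \<open>C\<close>-vertex at \<open>z\<close>.
\<close>

type_synonym cell = "bool \<times> vertex"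

fun corner :: "side \<Rightarrow> vertex" where
  "corner A = (1, 0)" | "corner B = (0, 1)" | "corner C = (0, 0)"

fun vert :: "cell \<Rightarrow> side \<Rightarrow> vertex" where
  "vert (s, z) k = (if s then z + corner k else z - corner k)"

fun flip :: "cell \<Rightarrow> side \<Rightarrow> cell" where
  "flip (s, z) l = (\<not> s, if s then z + (corner (nxt l) + corner (prv l))
                                else z - (corner (nxt l) + corner (prv l)))"

fun turned :: "vertex \<Rightarrow> cell \<Rightarrow> cell" where
  "turned w (s, z) = (\<not> s, w - z)"

lemma vert_flip: "vert (flip t l) k = vert t (nxt l) + vert t (prv l) - vert t k"
  by (cases t) auto

lemma flip_flip [simp]: "flip (flip t l) l = t"
  by (cases t) auto

lemma fst_flip [simp]: "fst (flip t l) = (\<not> fst t)"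
  by (cases t) auto

lemma flip_inj: "flip t l = flip t k \<Longrightarrow> l = k"
  by (cases t; cases l; cases k) (auto split: if_splits)

lemma cell_eqI:
  assumes "\<And>k. vert t k = vert t' k"
  shows "t = t'"
proof -
  obtain s x y s' x' y' where t: "t = (s, x, y)" and t': "t' = (s', x', y')"
    by (metis surj_pair)
  have "vert t A = vert t' A" "vert t B = vert t' B" "vert t C = vert t' C"
    by (rule assms)+
  then show ?thesis
    unfolding t t' by (cases s; cases s') simp_all
qed

lemma vert_turned [simp]: "vert (turned w t) k = w - vert t k"
  by (cases t) auto

lemma turned_flip: "turned w (flip t l) = flip (turned w t) l"
  by (cases t) auto

lemma turned_turned [simp]: "turned w (turned w t) = t"
  by (cases t) auto

lemma fst_turned [simp]: "fst (turned w t) = (\<not> fst t)"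
  by (cases t) auto

text \<open>Every edge of the triangulation lies in exactly two cells, one of each orientation; in
  coordinates this is a finite case check.\<close>

lemma cells_sharing_edge:
  assumes "vert t (nxt l) \<in> range (vert t')" "vert t (prv l) \<in> range (vert t')"
  shows "t' = t \<or> t' = flip t l"
proof -
  obtain k m where *: "vert t (nxt l) = vert t' k" "vert t (prv l) = vert t' m"
    using assms by auto
  obtain s x y s' x' y' where "t = (s, x, y)" "t' = (s', x', y')"
    by (metis surj_pair)
  with * show ?thesis
    by (cases l; cases k; cases m; cases s; cases s') auto
qed

declare vert.simps [simp del] flip.simps [simp del] turned.simps [simp del]

definition adj :: "vertex \<Rightarrow> vertex \<Rightarrow> bool" where
  "adj u v \<longleftrightarrow> (\<exists>t. u \<in> range (vert t) \<and> v \<in> range (vert t))"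

lemma adj_sym: "adj u v \<Longrightarrow> adj v u"
  unfolding adj_def by blast

lemma adjI: "adj (vert t k) (vert t m)"
  unfolding adj_def by blast

lemma adj_turned: "adj u v \<Longrightarrow> adj (w - u) (w - v)"
  unfolding adj_def
proof (elim exE conjE rangeE)
  fix t k m assume "u = vert t k" "v = vert t m"
  then have "w - u = vert (turned w t) k" "w - v = vert (turned w t) m" by simp_all
  then show "\<exists>t. w - u \<in> range (vert t) \<and> w - v \<in> range (vert t)"
    by (metis rangeI)
qed

lemma adj_right: "adj v (v + (1, 0))"
proof -
  have "v = vert (True, v) C" "v + (1, 0) = vert (True, v) A"
    by (auto simp: prod_eq_iff vert.simps)
  then show ?thesis using adjI by metis
qed

text \<open>A vertex of \<open>D\<close> with maximal first coordinate has its right neighbour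
  outside \<open>D\<close>.\<close>

lemma finite_nonempty_has_boundary:
  assumes "finite D" "D \<noteq> {}"
  shows "\<exists>p\<in>D. \<exists>q. q \<notin> D \<and> adj p q"
proof -
  have "Max (fst ` D) \<in> fst ` D"
    using assms by (intro Max_in) simp_all
  then obtain p where p: "p \<in> D" "fst p = Max (fst ` D)"
    by force
  have "p + (1, 0) \<notin> D"
  proof
    assume "p + (1, 0) \<in> D"
    then have "fst (p + (1, 0)) \<le> fst p"
      unfolding p(2) using assms(1) by (intro Max_ge imageI finite_imageI)
    then show False by simp
  qed
  with p(1) adj_right show ?thesis
    by blast
qed

text \<open>The combinatorial data kept from a closed trajectory: cell \<open>t i\<close> is entered
  through side \<open>l i\<close> and left through side \<open>l (i + 1)\<close>. Closedness of the
  curve enters only through \<open>finite_cells\<close>.\<close>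

locale contour =
  fixes t :: "int \<Rightarrow> cell" and l :: "int \<Rightarrow> side" and g :: "vertex \<Rightarrow> real"
  assumes step: "t (i + 1) = flip (t i) (l (i + 1))"
    and turn: "l (i + 1) \<noteq> l i"
    and crossed: "g (vert (t i) (nxt (l i))) * g (vert (t i) (prv (l i))) < 0"
    and finite_cells: "finite (range t)"
begin

lemma crossed_exit: "g (vert (t i) (nxt (l (i + 1)))) * g (vert (t i) (prv (l (i + 1)))) < 0"
  using crossed[of "i + 1"] by (simp add: step vert_flip mult.commute)

lemma g_nonzero: "g (vert (t i) k) \<noteq> 0"
proof -
  have "k \<in> {nxt (l i), prv (l i), nxt (l (i + 1)), prv (l (i + 1))}"
    using turn[of i] by (cases k; cases "l i"; cases "l (i + 1)") auto
  then show ?thesis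
    using crossed[of i] crossed_exit[of i] by auto
qed

text \<open>The three sides of a triangle cannot all join vertices of opposite sign. The distinct
  entry and exit sides already do, so the third side does not.\<close>

lemma mixed_is_crossed:
  assumes "g (vert (t i) k) * g (vert (t i) m) < 0"
  shows "{k, m} = {nxt (l i), prv (l i)} \<or> {k, m} = {nxt (l (i + 1)), prv (l (i + 1))}"
proof -
  define mixed where "mixed e \<longleftrightarrow> g (vert (t i) (nxt e)) * g (vert (t i) (prv e)) < 0" for e
  have "\<not> (mixed A \<and> mixed B \<and> mixed C)"
    by (auto simp: mixed_def mult_less_0_iff)
  moreover have "mixed (l i)" "mixed (l (i + 1))"
    using crossed crossed_exit by (simp_all add: mixed_def)
  ultimately have only: "e = l i \<or> e = l (i + 1)" if "mixed e" for e
    using turn[of i] that by (cases e; cases "l i"; cases "l (i + 1)") auto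
  have "k \<noteq> m" using assms by (auto simp: not_less)
  then obtain e where e: "{k, m} = {nxt e, prv e}"
    by (metis nxt.simps prv.simps side.exhaust insert_commute)
  with assms have "mixed e"
    by (auto simp: mixed_def doubleton_eq_iff mult.commute)
  with only e show ?thesis by blast
qed

text \<open>Only edges of cells in the strip count, since \<open>g\<close> may also change sign
  elsewhere, along other branches of its zero set.\<close>

definition cut :: "vertex \<Rightarrow> vertex \<Rightarrow> bool" where
  "cut p q \<longleftrightarrow> (\<exists>i. p \<in> range (vert (t i)) \<and> q \<in> range (vert (t i)) \<and> g p * g q < 0)"

lemma cut_sym: "cut p q = cut q p"
  by (auto simp: cut_def mult.commute)

text \<open>A cut edge is the entry or exit side of some \<open>t i\<close>, so the two cells
  containing it are \<open>t i\<close> and its predecessor or successor.\<close>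

lemma cut_cell:
  assumes "cut p q" "p \<in> range (vert u)" "q \<in> range (vert u)"
  shows "u \<in> range t"
proof -
  obtain i k m where i: "p = vert (t i) k" "q = vert (t i) m" "g p * g q < 0"
    using assms(1) unfolding cut_def by auto
  have prev: "t (i - 1) = flip (t i) (l i)"
    using step[of "i - 1"] by simp
  have "(\<exists>e\<in>{l i, l (i + 1)}. {k, m} = {nxt e, prv e})"
    using mixed_is_crossed[of i k m] i by auto
  then obtain e where e: "e \<in> {l i, l (i + 1)}" "{k, m} = {nxt e, prv e}"
    by blast
  then have "vert (t i) (nxt e) \<in> range (vert u)" "vert (t i) (prv e) \<in> range (vert u)"
    using assms i(1,2) by (auto simp: doubleton_eq_iff)
  then have "u = t i \<or> u = flip (t i) e"
    by (rule cells_sharing_edge)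
  then show ?thesis
    using e(1) step[of i] prev by (auto intro: rangeI) (metis rangeI)+
qed

lemma cut_iff_mixed: "cut (vert (t i) k) (vert (t i) m) \<longleftrightarrow> g (vert (t i) k) * g (vert (t i) m) < 0"
  by (auto simp: cut_def)

lemma mixed_iff: "g (vert (t i) k) * g (vert (t i) m) < 0 \<longleftrightarrow>
    (0 < g (vert (t i) k)) \<noteq> (0 < g (vert (t i) m))"
  using g_nonzero[of i k] g_nonzero[of i m] by (auto simp: mult_less_0_iff)

text \<open>A cell of the strip has two cut edges, any other cell none. So \<open>cut\<close> is a
  closed cochain modulo 2, which is what allows \<open>inside\<close> to be a potential for
  it.\<close>

lemma cut_triangle: "cut (vert u A) (vert u B) = (cut (vert u B) (vert u C) \<noteq> cut (vert u C) (vert u A))"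
proof (cases "u \<in> range t")
  case True
  then obtain i where u: "u = t i" by blast
  show ?thesis
    unfolding u cut_iff_mixed mixed_iff by argo
next
  case False
  then show ?thesis using cut_cell by blast
qed

section \<open>The vertices enclosed by the strip\<close>

lemma cut_bounded: "\<exists>M. \<forall>p q. cut p q \<longrightarrow> \<bar>fst p\<bar> < M \<and> \<bar>snd p\<bar> < M"
proof -
  have "e \<in> {A, B, C}" for e
    by (cases e) simp_all
  then have "finite (UNIV :: side set)"
    by (intro finite_subset[of UNIV "{A, B, C}"]) auto
  then have "finite (range (vert u))" for u
    by (rule finite_imageI)
  then have "finite (\<Union>u\<in>range t. range (vert u))"
    using finite_cells by blast
  then have fin: "finite ((\<lambda>p. \<bar>fst p\<bar> + \<bar>snd p\<bar>) ` (\<Union>u\<in>range t. range (vert u)))" (is "finite ?F")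
    by (rule finite_imageI)
  have "\<bar>fst p\<bar> < Max ?F + 1 \<and> \<bar>snd p\<bar> < Max ?F + 1" if "cut p q" for p q
  proof -
    have "\<bar>fst p\<bar> + \<bar>snd p\<bar> \<in> ?F"
      using that unfolding cut_def by blast
    then have "\<bar>fst p\<bar> + \<bar>snd p\<bar> \<le> Max ?F"
      by (rule Max_ge[OF fin])
    then show ?thesis by linarith
  qed
  then show ?thesis by blast
qed

text \<open>Ray casting to the right. The counted set is finite by \<open>cut_bounded\<close>, so
  the default cardinality 0 of infinite sets never occurs.\<close>

definition inside :: "vertex \<Rightarrow> bool" where
  "inside v \<longleftrightarrow> odd (card {x. fst v \<le> x \<and> cut (x, snd v) (x + 1, snd v)})"

lemma inside_horizontal: "inside (x, y) \<noteq> inside (x + 1, y) \<longleftrightarrow> cut (x, y) (x + 1, y)"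
proof -
  obtain M where M: "\<And>p q. cut p q \<Longrightarrow> \<bar>fst p\<bar> < M \<and> \<bar>snd p\<bar> < M"
    using cut_bounded by blast
  define S where "S = {x'. x + 1 \<le> x' \<and> cut (x', y) (x' + 1, y)}"
  have "x' \<in> {-M..M}" if "x' \<in> S" for x'
    using M[of "(x', y)" "(x' + 1, y)"] that unfolding S_def by auto
  then have "S \<subseteq> {-M..M}" by blast
  then have "finite S"
    using finite_subset by blast
  have split: "x \<le> x' \<longleftrightarrow> x' = x \<or> x + 1 \<le> x'" for x'
    by linarith
  have "{x'. x \<le> x' \<and> cut (x', y) (x' + 1, y)} =
      (if cut (x, y) (x + 1, y) then insert x S else S)"
    unfolding S_def split by auto
  moreover have "x \<notin> S" by (simp add: S_def)
  ultimately show ?thesis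
    using \<open>finite S\<close> unfolding inside_def fst_conv snd_conv S_def[symmetric]
    by simp
qed

lemma not_inside_far:
  assumes "\<And>p q. cut p q \<Longrightarrow> \<bar>fst p\<bar> < M \<and> \<bar>snd p\<bar> < M" "M \<le> x \<or> M \<le> \<bar>y\<bar>"
  shows "\<not> inside (x, y)"
proof -
  have "\<not> (x \<le> x' \<and> cut (x', y) (x' + 1, y))" for x'
    using assms(1)[of "(x', y)" "(x' + 1, y)"] assms(2) by auto
  then have empty: "{x'. x \<le> x' \<and> cut (x', y) (x' + 1, y)} = {}"
    by blast
  show ?thesis
    unfolding inside_def fst_conv snd_conv empty by simp
qed

lemma cut_up: "cut (x, y) (x, y + 1) =
    (cut (x, y) (x + 1, y) \<noteq> cut (x + 1, y) (x, y + 1))"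
  using cut_triangle[of "(True, x, y)"] by (auto simp: cut_sym vert.simps)

lemma cut_down: "cut (x + 1, y) (x + 1, y + 1) =
    (cut (x, y + 1) (x + 1, y + 1) \<noteq> cut (x + 1, y) (x, y + 1))"
  using cut_triangle[of "(False, x + 1, y + 1)"] by (auto simp: cut_sym vert.simps)

text \<open>Far to the right neither side of the equivalence holds. Going one column to the left,
  the square between the columns consists of two cells, and \<open>cut_triangle\<close> for both
  transfers the equivalence.\<close>

lemma inside_vertical: "inside (x, y) \<noteq> inside (x, y + 1) \<longleftrightarrow> cut (x, y) (x, y + 1)"
proof -
  obtain M where M: "\<And>p q. cut p q \<Longrightarrow> \<bar>fst p\<bar> < M \<and> \<bar>snd p\<bar> < M"
    using cut_bounded by blast
  have far: "inside (x, y) \<noteq> inside (x, y + 1) \<longleftrightarrow> cut (x, y) (x, y + 1)" if "x \<ge> M" for x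
  proof -
    have "\<not> inside (x, y)" "\<not> inside (x, y + 1)"
      by (rule not_inside_far[OF M]; use that in simp)+
    moreover have "\<not> cut (x, y) (x, y + 1)"
      using M[of "(x, y)" "(x, y + 1)"] that by auto
    ultimately show ?thesis by simp
  qed
  show ?thesis
  proof (cases "x \<ge> M")
    case False
    then have "x \<le> M" by simp
    then show ?thesis
    proof (induction x rule: int_le_induct)
      case base
      show ?case by (rule far) simp
    next
      case (step x)
      have "x - 1 + 1 = x" by simp
      with step show ?case
        using inside_horizontal[of "x - 1" y] inside_horizontal[of "x - 1" "y + 1"]
          cut_up[of "x - 1" y] cut_down[of "x - 1" y]
        by metis
    qed
  qed (rule far)
qed

lemma inside_diagonal: "inside (x + 1, y) \<noteq> inside (x, y + 1) \<longleftrightarrow> cut (x + 1, y) (x, y + 1)"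
  using inside_horizontal[of x y] inside_vertical[of x y] cut_up[of x y] by argo

lemma inside_iff_cut:
  assumes "adj p q"
  shows "inside p \<noteq> inside q \<longleftrightarrow> cut p q"
proof -
  obtain t k m where pq: "p = vert t k" "q = vert t m"
    using assms unfolding adj_def by blast
  obtain s x y where t: "t = (s, x, y)"
    by (metis surj_pair)
  have irrefl: "\<not> cut v v" for v
    by (auto simp: cut_def not_less)
  have up: "inside (x, y) \<noteq> inside (x + 1, y) \<longleftrightarrow> cut (x, y) (x + 1, y)"
    "inside (x, y) \<noteq> inside (x, y + 1) \<longleftrightarrow> cut (x, y) (x, y + 1)"
    "inside (x + 1, y) \<noteq> inside (x, y + 1) \<longleftrightarrow> cut (x + 1, y) (x, y + 1)"
    by (rule inside_horizontal inside_vertical inside_diagonal)+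
  have down: "inside (x - 1, y) \<noteq> inside (x, y) \<longleftrightarrow> cut (x - 1, y) (x, y)"
    "inside (x, y - 1) \<noteq> inside (x, y) \<longleftrightarrow> cut (x, y - 1) (x, y)"
    "inside (x, y - 1) \<noteq> inside (x - 1, y) \<longleftrightarrow> cut (x, y - 1) (x - 1, y)"
    using inside_horizontal[of "x - 1" y] inside_vertical[of x "y - 1"]
      inside_diagonal[of "x - 1" "y - 1"] by simp_all
  note edges = up[symmetric] down[symmetric]
  have edges': "cut (x + 1, y) (x, y) \<longleftrightarrow> inside (x, y) \<noteq> inside (x + 1, y)"
    "cut (x, y + 1) (x, y) \<longleftrightarrow> inside (x, y) \<noteq> inside (x, y + 1)"
    "cut (x, y + 1) (x + 1, y) \<longleftrightarrow> inside (x + 1, y) \<noteq> inside (x, y + 1)"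
    "cut (x, y) (x - 1, y) \<longleftrightarrow> inside (x - 1, y) \<noteq> inside (x, y)"
    "cut (x, y) (x, y - 1) \<longleftrightarrow> inside (x, y - 1) \<noteq> inside (x, y)"
    "cut (x - 1, y) (x, y - 1) \<longleftrightarrow> inside (x, y - 1) \<noteq> inside (x - 1, y)"
    by (subst cut_sym, rule edges)+
  show ?thesis
    unfolding pq t
    by (cases s; cases k; cases m; simp add: vert.simps irrefl edges edges')
      auto
qed

lemma finite_inside: "finite {v. inside v}"
proof -
  obtain M where M: "\<And>p q. cut p q \<Longrightarrow> \<bar>fst p\<bar> < M \<and> \<bar>snd p\<bar> < M"
    using cut_bounded by blast
  \<comment> \<open>The rays make \<open>inside\<close> false at the far right, top and bottom only.
    In a column far to the left no vertical edge is cut, so the value at height \<open>M\<close> is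
    carried downwards.\<close>
  have left: "\<not> inside (x, y)" if "x \<le> - M" for x y
  proof (cases "y \<le> M")
    case True
    then show ?thesis
    proof (induction y rule: int_le_induct)
      case base
      show ?case by (intro not_inside_far[OF M] disjI2 abs_ge_self)
    next
      case (step y)
      moreover have "\<not> cut (x, y - 1) (x, y)"
        using M[of "(x, y - 1)" "(x, y)"] that by auto
      ultimately show ?case
        using inside_vertical[of x "y - 1"] by simp
    qed
  next
    case False
    then show ?thesis by (intro not_inside_far[OF M]) auto
  qed
  have "v \<in> {-M..M} \<times> {-M..M}" if "inside v" for v
  proof -
    have "\<not> fst v \<le> - M"
      using left[of "fst v" "snd v"] that by auto
    moreover have "\<not> (M \<le> fst v \<or> M \<le> \<bar>snd v\<bar>)"
      using not_inside_far[where x = "fst v" and y = "snd v", OF M] that by auto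
    ultimately show ?thesis
      by (cases v) auto
  qed
  then have "{v. inside v} \<subseteq> {-M..M} \<times> {-M..M}"
    by blast
  then show ?thesis
    by (rule finite_subset) simp
qed

end

section \<open>Components of a sign pattern\<close>

lemma int_shift_invariant:
  fixes P :: "int \<Rightarrow> bool"
  assumes "P a" "\<And>i. P i = P (i + 1)"
  shows "P i"
proof (induction i rule: int_induct[of _ a])
  case base
  show ?case by (rule assms)
next
  case (step1 i)
  then show ?case using assms(2)[of i] by simp
next
  case (step2 i)
  then show ?case using assms(2)[of "i - 1"] by simp
qed

text \<open>For positive \<open>c\<close>, the connected component of \<open>c\<close> among the
  positive vertices.\<close>

definition component :: "(vertex \<Rightarrow> real) \<Rightarrow> vertex \<Rightarrow> vertex set" where
  "component g c = {(u, v). adj u v \<and> 0 < g u \<and> 0 < g v}\<^sup>* `` {c}"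

lemma component_refl: "c \<in> component g c"
  by (simp add: component_def)

lemma component_step:
  assumes "u \<in> component g c" "adj u v" "0 < g u" "0 < g v"
  shows "v \<in> component g c"
  using assms unfolding component_def by (auto intro: rtrancl_into_rtrancl)

lemma component_induct [consumes 1, case_names base step]:
  assumes "v \<in> component g c" "P c"
    and "\<And>u v. u \<in> component g c \<Longrightarrow> P u \<Longrightarrow> adj u v \<Longrightarrow> 0 < g u \<Longrightarrow> 0 < g v \<Longrightarrow> P v"
  shows "P v"
proof -
  have "(c, v) \<in> {(u, v). adj u v \<and> 0 < g u \<and> 0 < g v}\<^sup>*"
    using assms(1) by (simp add: component_def)
  then show ?thesis
  proof (induction rule: rtrancl_induct)
    case base
    show ?case by (rule assms(2))
  next
    case (step u v)
    then show ?case
      using assms(3)[of u v] by (simp add: component_def)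
  qed
qed

lemma component_positive: "v \<in> component g c \<Longrightarrow> 0 < g c \<Longrightarrow> 0 < g v"
  by (induction rule: component_induct) auto

lemma component_joined:
  assumes "u \<in> component g c" "v \<in> component g c"
  shows "v \<in> component g u"
proof -
  let ?R = "{(u, v). adj u v \<and> 0 < g u \<and> 0 < g v}"
  have "sym (?R\<^sup>*)"
    by (intro sym_rtrancl symI) (auto intro: adj_sym)
  then show ?thesis
    using assms unfolding component_def by (auto dest: symD intro: rtrancl_trans)
qed

definition centrally_symmetric :: "vertex set \<Rightarrow> bool" where
  "centrally_symmetric K \<longleftrightarrow> (\<exists>w. \<forall>v\<in>K. w - v \<in> K)"

section \<open>Signs along the strip and symmetry of the enclosed set\<close>

context contour
begin

lemma step_back: "t (i - 1) = flip (t i) (l i)"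
  using step[of "i - 1"] by simp

lemma shared_vertex:
  assumes "e \<noteq> l (i + 1)"
  shows "vert (t i) e \<in> range (vert (t (i + 1)))"
proof -
  have "e = nxt (l (i + 1)) \<or> e = prv (l (i + 1))"
    using assms by (cases e; cases "l (i + 1)") auto
  moreover have "vert (t (i + 1)) (prv (l (i + 1))) = vert (t i) (nxt (l (i + 1)))"
    "vert (t (i + 1)) (nxt (l (i + 1))) = vert (t i) (prv (l (i + 1)))"
    unfolding step by (simp_all add: vert_flip)
  ultimately show ?thesis
    by (metis rangeI)
qed

definition boundary :: "vertex set" where
  "boundary = (\<Union>i. range (vert (t i)))"

lemma boundaryI: "vert (t i) k \<in> boundary"
  unfolding boundary_def by blast

lemma boundary_g_nonzero: "v \<in> boundary \<Longrightarrow> g v \<noteq> 0"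
  using g_nonzero unfolding boundary_def by blast

lemma cut_boundary: "cut p q \<Longrightarrow> p \<in> boundary \<and> q \<in> boundary \<and> (0 < g p) = (g q < 0)"
  unfolding cut_def boundary_def by (auto simp: mult_less_0_iff)

lemma inside_cell: "inside (vert (t i) k) \<noteq> inside (vert (t i) m) \<longleftrightarrow>
    (0 < g (vert (t i) k)) \<noteq> (0 < g (vert (t i) m))"
  using inside_iff_cut[OF adjI] cut_iff_mixed mixed_iff by simp

lemma exit_side_sign: "\<exists>e. e \<noteq> l (i + 1) \<and> (0 < g (vert (t i) e)) = b"
proof -
  have "(0 < g (vert (t i) (nxt (l (i + 1))))) \<noteq> (0 < g (vert (t i) (prv (l (i + 1)))))"
    using crossed_exit[of i] mixed_iff by simp
  then show ?thesis by (metis nxt_prv_distinct(1,2))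
qed

text \<open>Within a cell of the strip, \<open>inside\<close> and the sign of \<open>g\<close>
  change together. So agreement at one vertex extends to the cell, and through shared vertices along
  the strip.\<close>

lemma inside_boundary:
  "\<exists>b. \<forall>v\<in>boundary. inside v \<longleftrightarrow> (0 < g v) = b"
proof -
  define P where "P b i \<longleftrightarrow> (\<forall>k. inside (vert (t i) k) \<longleftrightarrow> (0 < g (vert (t i) k)) = b)" for b i
  have cell: "P b i" if "inside (vert (t i) k) \<longleftrightarrow> (0 < g (vert (t i) k)) = b" for b i k
    unfolding P_def using inside_cell that by blast
  define b where "b \<longleftrightarrow> inside (vert (t 0) A) = (0 < g (vert (t 0) A))"
  have "P b 0"
    by (rule cell[of 0 A]) (auto simp: b_def)
  have "P b i" for i
  proof (rule int_shift_invariant[of "P b", OF \<open>P b 0\<close>])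
    fix i
    obtain e where "e \<noteq> l (i + 1)"
      using exit_side_sign by blast
    then obtain m where "vert (t i) e = vert (t (i + 1)) m"
      using shared_vertex by blast
    then show "P b i = P b (i + 1)"
      using cell P_def by metis
  qed
  then show ?thesis
    unfolding P_def boundary_def by blast
qed

text \<open>Positive vertices of a cell are adjacent, and consecutive cells share the positive end
  of the crossed side, so a single component follows the strip.\<close>

lemma positive_boundary_component:
  assumes "v \<in> boundary" "0 < g v" "c \<in> boundary" "0 < g c"
  shows "v \<in> component g c"
proof -
  define P where "P i \<longleftrightarrow> (\<forall>k. 0 < g (vert (t i) k) \<longrightarrow> vert (t i) k \<in> component g c)" for i
  have cell: "P i" if "0 < g (vert (t i) k)" "vert (t i) k \<in> component g c" for i k
    unfolding P_def using component_step[OF that(2) adjI that(1)] by blast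
  obtain j k where j: "c = vert (t j) k"
    using assms(3) unfolding boundary_def by blast
  then have "P j"
    using cell[of j k] assms(4) component_refl by metis
  have "P i" for i
  proof (rule int_shift_invariant[of P, OF \<open>P j\<close>])
    fix i
    obtain e where e: "e \<noteq> l (i + 1)" "0 < g (vert (t i) e)"
      using exit_side_sign[of i True] by auto
    then obtain m where "vert (t i) e = vert (t (i + 1)) m"
      using shared_vertex by blast
    then show "P i = P (i + 1)"
      using cell P_def e by metis
  qed
  then show ?thesis
    using assms(1,2) unfolding P_def boundary_def by blast
qed

text \<open>The same walk on the other side of the curve, as an induction principle for an arbitrary
  property.\<close>

lemma nonpositive_boundary_invariant:
  assumes "\<And>p q. p \<in> boundary \<Longrightarrow> q \<in> boundary \<Longrightarrow> adj p q \<Longrightarrow> \<not> 0 < g p \<Longrightarrow> \<not> 0 < g q \<Longrightarrow> Q p \<Longrightarrow> Q q"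
    and "v \<in> boundary" "\<not> 0 < g v" "c \<in> boundary" "\<not> 0 < g c" "Q c"
  shows "Q v"
proof -
  define P where "P i \<longleftrightarrow> (\<forall>k. \<not> 0 < g (vert (t i) k) \<longrightarrow> Q (vert (t i) k))" for i
  have cell: "P i" if "\<not> 0 < g (vert (t i) k)" "Q (vert (t i) k)" for i k
    unfolding P_def using assms(1)[OF boundaryI boundaryI adjI] that by blast
  obtain j k where j: "c = vert (t j) k"
    using assms(4) unfolding boundary_def by blast
  then have "P j"
    using cell[of j k] assms(5,6) by metis
  have "P i" for i
  proof (rule int_shift_invariant[of P, OF \<open>P j\<close>])
    fix i
    obtain e where e: "e \<noteq> l (i + 1)" "\<not> 0 < g (vert (t i) e)"
      using exit_side_sign[of i False] by auto
    then obtain m where "vert (t i) e = vert (t (i + 1)) m"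
      using shared_vertex by blast
    then show "P i = P (i + 1)"
      using cell P_def e by metis
  qed
  then show ?thesis
    using assms(2,3) unfolding P_def boundary_def by blast
qed

lemma crossing_boundary:
  assumes "adj p q" "inside p \<noteq> inside q"
  shows "p \<in> boundary" "q \<in> boundary" "(0 < g p) = (g q < 0)"
  using cut_boundary[of p q] inside_iff_cut[OF assms(1)] assms(2) by blast+

text \<open>The component \<open>K\<close> need not fill the enclosed set, which may contain
  vertices where \<open>g\<close> is not positive. Its symmetry controls the reflection along the
  strip; the rest follows by comparing the enclosed set with its reflected copy.\<close>

lemma inside_centrally_symmetric:
  assumes inside: "\<And>v. v \<in> boundary \<Longrightarrow> inside v \<longleftrightarrow> 0 < g v"
    and sym: "\<And>c. 0 < g c \<Longrightarrow> finite (component g c) \<Longrightarrow> centrally_symmetric (component g c)"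
  shows "\<exists>w. \<forall>v. inside (w - v) = inside v"
proof -
  obtain e where e: "0 < g (vert (t 0) e)"
    using exit_side_sign[of 0 True] by auto
  define c where "c = vert (t 0) e"
  define K where "K = component g c"
  have c: "c \<in> boundary" "0 < g c"
    using e boundaryI by (simp_all add: c_def)
  \<comment> \<open>Leaving the enclosed set means following a cut edge, whose ends have opposite
    signs.\<close>
  have K_inside: "inside v" if "v \<in> K" for v
    using that unfolding K_def
  proof (induction rule: component_induct)
    case base
    show ?case using inside[OF c(1)] c(2) by simp
  next
    case (step u v)
    show ?case
      using crossing_boundary(3)[OF \<open>adj u v\<close>] \<open>inside u\<close> \<open>0 < g u\<close> \<open>0 < g v\<close> by auto
  qed
  have boundary_K: "v \<in> K" if "v \<in> boundary" "inside v" for v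
    unfolding K_def using positive_boundary_component[OF that(1) _ c] inside[OF that(1)] that(2)
    by simp
  have "{v. v \<in> K} \<subseteq> {v. inside v}"
    using K_inside by (rule Collect_mono[OF impI])
  then have "finite (component g c)"
    using finite_subset[OF _ finite_inside] unfolding K_def by simp
  then obtain w where w: "\<And>v. v \<in> K \<Longrightarrow> w - v \<in> K"
    using sym[OF c(2)] unfolding K_def centrally_symmetric_def by blast
  have involution: "w - (w - v) = v" for v
    by simp
  have adj_w: "adj (w - p) (w - q)" if "adj p q" for p q
    using that by (rule adj_turned)
  have refl_inside: "inside (w - v)" if "v \<in> boundary" "inside v" for v
    using boundary_K[OF that] w K_inside by blast
  \<comment> \<open>Otherwise \<open>w - p\<close> would be an enclosed vertex of the strip, and
    reflecting it back would put \<open>p\<close> inside.\<close>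
  have outside_step: "inside (w - q)"
    if "p \<in> boundary" "adj p q" "\<not> inside p" "inside (w - p)" for p q
  proof (rule ccontr)
    assume "\<not> inside (w - q)"
    then have "w - p \<in> boundary"
      using crossing_boundary(1)[OF adj_w[OF that(2)]] that(4) by simp
    then have "inside (w - (w - p))"
      using refl_inside that(4) by blast
    then show False
      using that(3) involution by simp
  qed
  have outside_cases: "(\<forall>v\<in>boundary. \<not> inside v \<longrightarrow> inside (w - v)) \<or>
      (\<forall>v\<in>boundary. \<not> inside v \<longrightarrow> \<not> inside (w - v))"
  proof -
    have "inside (w - v)"
      if "v \<in> boundary" "\<not> inside v" "u \<in> boundary" "\<not> inside u" "inside (w - u)" for u v
      by (rule nonpositive_boundary_invariant[of "\<lambda>v. inside (w - v)" v u])
        (use that inside outside_step in auto)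
    then show ?thesis by blast
  qed
  have finite_refl: "finite {v. inside (w - v)}"
  proof (rule finite_subset)
    show "finite ((\<lambda>v. w - v) ` {v. inside v})"
      using finite_inside by (rule finite_imageI)
    show "{v. inside (w - v)} \<subseteq> (\<lambda>v. w - v) ` {v. inside v}"
    proof
      fix v assume "v \<in> {v. inside (w - v)}"
      then show "v \<in> (\<lambda>v. w - v) ` {v. inside v}"
        by (intro image_eqI[of _ _ "w - v"]) simp_all
    qed
  qed
  have *: "inside (w - v)" if "inside v" for v
  proof (rule ccontr)
    assume v: "\<not> inside (w - v)"
    from outside_cases show False
    proof
      assume all_in: "\<forall>v\<in>boundary. \<not> inside v \<longrightarrow> inside (w - v)"
      \<comment> \<open>No edge can leave the union: it, or its reflection, would be cut, and its
        outer end would be a strip vertex whose reflection is enclosed.\<close>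
      let ?D = "{v. inside v} \<union> {v. inside (w - v)}"
      have "finite ?D" "?D \<noteq> {}"
        using finite_inside finite_refl that by blast+
      then obtain p q where pq: "p \<in> ?D" "q \<notin> ?D" "adj p q"
        using finite_nonempty_has_boundary[of ?D] by blast
      then have q: "\<not> inside q" "\<not> inside (w - q)"
        by auto
      show False
      proof (cases "inside p")
        case True
        then have "q \<in> boundary"
          using crossing_boundary(2)[OF pq(3)] q by simp
        then show False using all_in q by blast
      next
        case False
        then have "inside (w - p)"
          using pq(1) by simp
        then have "w - q \<in> boundary"
          using crossing_boundary(2)[OF adj_w[OF pq(3)]] q by simp
        then have "inside (w - (w - q))" using all_in q by blast
        then show False using q involution by simp
      qed
    next
      assume all_out: "\<forall>v\<in>boundary. \<not> inside v \<longrightarrow> \<not> inside (w - v)"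
      \<comment> \<open>An edge leaving the difference would again be cut, directly or after
        reflection, which makes \<open>p\<close> or \<open>w - p\<close> a strip vertex with known
        reflection.\<close>
      let ?D = "{v. inside v} - {v. inside (w - v)}"
      have "finite ?D" "?D \<noteq> {}"
        using finite_inside that v by blast+
      then obtain p q where pq: "p \<in> ?D" "q \<notin> ?D" "adj p q"
        using finite_nonempty_has_boundary[of ?D] by blast
      then have p: "inside p" "\<not> inside (w - p)"
        by auto
      show False
      proof (cases "inside q")
        case True
        then have "inside (w - q)"
          using pq(2) by simp
        then have "w - p \<in> boundary"
          using crossing_boundary(1)[OF adj_w[OF pq(3)]] p by simp
        then have "\<not> inside (w - (w - p))" using all_out p by blast
        then show False using p involution by simp
      next
        case False
        then have "p \<in> boundary"
          using crossing_boundary(1)[OF pq(3)] p by simp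
        then show False using refl_inside p by blast
      qed
    qed
  qed
  have "inside (w - v) = inside v" for v
    using *[of v] *[of "w - v"] involution by auto
  then show ?thesis by blast
qed

section \<open>From central symmetry to an odd period of the coding\<close>

lemma inside_entry_side: "inside (vert (t i) (nxt (l i))) = inside (vert (t j) (nxt (l j)))"
proof -
  define P where "P i \<longleftrightarrow> inside (vert (t i) (nxt (l i))) = inside (vert (t j) (nxt (l j)))" for i
  have "P i"
  proof (rule int_shift_invariant[of P j])
    show "P j" by (simp add: P_def)
    fix i
    \<comment> \<open>The end common to both crossed sides is separated from the other two ends. So
      the \<open>nxt\<close> end of the entry side agrees with the \<open>prv\<close> end of the
      exit side, which is the \<open>nxt\<close> end in the next cell: the enclosed set stays on the
      same hand.\<close>
    have "inside (vert (t i) (nxt (l i))) \<noteq> inside (vert (t i) (prv (l i)))"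
      using crossed[of i] mixed_iff inside_cell by simp
    moreover have "inside (vert (t i) (nxt (l (i + 1)))) \<noteq> inside (vert (t i) (prv (l (i + 1))))"
      using crossed_exit[of i] mixed_iff inside_cell by simp
    moreover have "vert (t (i + 1)) (nxt (l (i + 1))) = vert (t i) (prv (l (i + 1)))"
      unfolding step by (simp add: vert_flip)
    ultimately show "P i = P (i + 1)"
      unfolding P_def using turn[of i] by (cases "l i"; cases "l (i + 1)") auto
  qed
  then show ?thesis by (simp add: P_def)
qed

lemma parity: "fst (t i) = (fst (t 0) = even i)"
proof (rule int_shift_invariant[of "\<lambda>i. fst (t i) = (fst (t 0) = even i)" 0])
  fix i show "(fst (t i) = (fst (t 0) = even i)) = (fst (t (i + 1)) = (fst (t 0) = even (i + 1)))"
    by (auto simp: step)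
qed simp

lemma turned_shift:
  assumes "turned w (t 0) = t m" "\<And>i. l (i + m) = l i"
  shows "turned w (t i) = t (i + m)"
proof (rule int_shift_invariant[of "\<lambda>i. turned w (t i) = t (i + m)" 0])
  show "turned w (t 0) = t (0 + m)" using assms(1) by simp
  fix i
  have eq: "turned w (t (i + 1)) = flip (turned w (t i)) (l (i + 1))"
    unfolding step turned_flip ..
  have eq': "t (i + 1 + m) = flip (t (i + m)) (l (i + 1))"
    using assms(2)[of "i + 1"] step[of "i + m"] by (simp add: ac_simps)
  show "(turned w (t i) = t (i + m)) = (turned w (t (i + 1)) = t (i + 1 + m))"
    unfolding eq eq' by (metis flip_flip)
qed

text \<open>For odd \<open>m\<close> the cells \<open>t 0\<close> and \<open>t m\<close> have
  opposite orientations, so a central symmetry exchanges them; \<open>w\<close> is the sum of their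
  \<open>C\<close>-vertices. It advances the sequence by \<open>m\<close>, and its square is the
  identity.\<close>

lemma cell_period:
  assumes "odd m" "\<And>i. l (i + m) = l i"
  shows "t (i + 2 * m) = t i"
proof -
  define w where "w = snd (t 0) + snd (t m)"
  have "turned w (t 0) = t m"
    using parity[of m] assms(1) by (cases "t 0"; cases "t m") (auto simp: w_def turned.simps)
  then have "turned w (t i) = t (i + m)" for i
    using turned_shift assms(2) by blast
  then have "turned w (turned w (t i)) = t (i + m + m)"
    by simp
  then show ?thesis
    by (simp add: add.assoc)
qed

text \<open>The symmetry permutes cut edges and hence strip cells, and keeps the direction of
  travel. So it shifts the sequence, by an odd amount because it reverses cell orientations.\<close>

lemma odd_period_of_symmetric_inside:
  assumes "\<forall>v. inside (w - v) = inside v"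
  shows "\<exists>j. odd j \<and> (\<forall>i. l (i + j) = l i)"
proof -
  have w: "inside (w - v) = inside v" for v
    using assms by blast
  have mixed: "inside (vert (t i) (nxt (l i))) \<noteq> inside (vert (t i) (prv (l i)))" for i
    using crossed[of i] mixed_iff inside_cell by simp
  have mixed_exit: "inside (vert (t i) (nxt (l (i + 1)))) \<noteq> inside (vert (t i) (prv (l (i + 1))))" for i
    using crossed_exit[of i] mixed_iff inside_cell by simp
  have "inside (vert (turned w (t 0)) (nxt (l 0))) \<noteq> inside (vert (turned w (t 0)) (prv (l 0)))"
    using mixed[of 0] unfolding vert_turned w .
  then have "cut (vert (turned w (t 0)) (nxt (l 0))) (vert (turned w (t 0)) (prv (l 0)))"
    using inside_iff_cut[OF adjI] by blast
  then obtain j where j: "turned w (t 0) = t j"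
    using cut_cell by blast
  \<comment> \<open>Of the two sides with differently placed ends, the entry side is recognized by
    \<open>inside\<close> at its \<open>nxt\<close> end, which is constant along the strip.\<close>
  have same: "l i = l k" if "turned w (t i) = t k" for i k
  proof -
    have "inside (vert (t k) e) = inside (vert (t i) e)" for e
      unfolding that[symmetric] vert_turned w ..
    then show ?thesis
      using mixed[of i] mixed[of k] inside_entry_side[of i k]
      by (cases "l i"; cases "l k") auto
  qed
  have exit: "l (i + 1) = l (k + 1)" if "turned w (t i) = t k" for i k
  proof -
    have "inside (vert (t k) e) = inside (vert (t i) e)" for e
      unfolding that[symmetric] vert_turned w ..
    moreover have "inside (vert (t i) (prv (l (i + 1)))) = inside (vert (t k) (prv (l (k + 1))))"
      using inside_entry_side[of "i + 1" "k + 1"] by (simp add: step vert_flip)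
    ultimately show ?thesis
      using mixed_exit[of i] mixed_exit[of k]
      by (cases "l (i + 1)"; cases "l (k + 1)") auto
  qed
  have shift: "turned w (t i) = t (i + j)" for i
  proof (rule int_shift_invariant[of "\<lambda>i. turned w (t i) = t (i + j)" 0])
    show "turned w (t 0) = t (0 + j)" using j by simp
    fix i
    show "(turned w (t i) = t (i + j)) = (turned w (t (i + 1)) = t (i + 1 + j))"
    proof
      assume "turned w (t i) = t (i + j)"
      then have "turned w (t (i + 1)) = t (i + j + 1)"
        using exit[of i "i + j"] by (simp add: turned_flip step)
      then show "turned w (t (i + 1)) = t (i + 1 + j)"
        by (simp add: ac_simps)
    next
      assume *: "turned w (t (i + 1)) = t (i + 1 + j)"
      then show "turned w (t i) = t (i + j)"
        using step_back[of "i + 1"] step_back[of "i + 1 + j"] same[OF *]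
        by (metis turned_flip add_diff_cancel_right' add.commute add.assoc)
    qed
  qed
  have "fst (t j) = (\<not> fst (t 0))"
    unfolding j[symmetric] by (rule fst_turned)
  then have "odd j"
    using parity[of j] by argo
  moreover have "l (i + j) = l i" for i
    using same[OF shift] by (rule sym)
  ultimately show ?thesis
    by blast
qed

end

lemma contour_uminus: "contour t l g \<Longrightarrow> contour t l (\<lambda>v. - g v)"
  unfolding contour_def minus_mult_minus .

text \<open>The curve may enclose its positive or its negative side; replacing \<open>g\<close> by
  its negative interchanges the two.\<close>

lemma (in contour) odd_coding_period:
  assumes "\<And>c. 0 < g c \<Longrightarrow> finite (component g c) \<Longrightarrow> centrally_symmetric (component g c)"
    and "\<And>c. g c < 0 \<Longrightarrow> finite (component (\<lambda>v. - g v) c) \<Longrightarrow>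
      centrally_symmetric (component (\<lambda>v. - g v) c)"
  shows "\<exists>j. odd j \<and> (\<forall>i. l (i + j) = l i)"
proof -
  obtain b where b: "\<forall>v\<in>boundary. inside v \<longleftrightarrow> (0 < g v) = b"
    using inside_boundary by blast
  show ?thesis
  proof (cases b)
    case True
    then have "inside v \<longleftrightarrow> 0 < g v" if "v \<in> boundary" for v
      using bspec[OF b that] True by simp
    then obtain w where "\<forall>v. inside (w - v) = inside v"
      using inside_centrally_symmetric[OF _ assms(1)] by blast
    then show ?thesis by (rule odd_period_of_symmetric_inside)
  next
    case False
    interpret neg: contour t l "\<lambda>v. - g v"
      using contour_uminus contour_axioms by blast
    have "neg.inside v \<longleftrightarrow> 0 < - g v" if "v \<in> neg.boundary" for v
    proof -
      have "neg.inside v = inside v"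
        unfolding inside_def neg.inside_def cut_def neg.cut_def by simp
      moreover have "v \<in> boundary"
        using that unfolding boundary_def neg.boundary_def .
      ultimately show ?thesis
        using bspec[OF b, of v] boundary_g_nonzero[of v] False by auto
    qed
    moreover have "centrally_symmetric (component (\<lambda>v. - g v) c)"
      if "0 < - g c" "finite (component (\<lambda>v. - g v) c)" for c
      using assms(2) that by simp
    ultimately obtain w where "\<forall>v. neg.inside (w - v) = neg.inside v"
      using neg.inside_centrally_symmetric by blast
    then show ?thesis by (rule neg.odd_period_of_symmetric_inside)
  qed
qed

section \<open>Reflections of the circle; periods of words\<close>

lemma circle_component_symmetric:
  fixes X :: "vertex \<Rightarrow> complex"
  assumes norm: "\<And>v. norm (X v) = 1"
    and mult: "\<And>a b v. X (a + b - v) * X v = X a * X b"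
    and g: "\<And>v. g v = r * Re (X v) - c" and "r > 0"
    and pos: "0 < g v0" and fin: "finite (component g v0)"
  shows "centrally_symmetric (component g v0)"
proof -
  define K where "K = component g v0"
  define \<theta> where "\<theta> v = Arg (X v)" for v
  have X: "X v = cis (\<theta> v)" for v
    using cis_Arg[of "X v"] norm[of v] by (simp add: \<theta>_def sgn_div_norm) (metis norm_zero zero_neq_one)
  have range: "- pi < \<theta> v" "\<theta> v \<le> pi" for v
    using Arg_bounded[of "X v"] by (simp_all add: \<theta>_def)
  have "finite (\<theta> ` K)" "\<theta> ` K \<noteq> {}"
    using fin component_refl[of v0 g] by (auto simp: K_def)
  then obtain a b where a: "a \<in> K" "\<theta> a = Max (\<theta> ` K)" and b: "b \<in> K" "\<theta> b = Min (\<theta> ` K)"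
    by (metis (no_types, lifting) Max_in Min_in imageE)
  have bounds: "\<theta> b \<le> \<theta> v" "\<theta> v \<le> \<theta> a" if "v \<in> K" for v
    using that \<open>finite (\<theta> ` K)\<close> by (simp_all add: a b)
  \<comment> \<open>On an interval of principal angles the cosine is least at one of the
    ends.\<close>
  have positive: "0 < g v" if "\<theta> b \<le> \<theta> v" "\<theta> v \<le> \<theta> a" for v
  proof -
    have "0 < g a" "0 < g b"
      using component_positive pos a b by (auto simp: K_def)
    moreover have "cos (\<theta> a) \<le> cos (\<theta> v)" if "0 \<le> \<theta> v"
      using that \<open>\<theta> v \<le> \<theta> a\<close> range[of a] by (intro cos_monotone_0_pi_le) auto
    moreover have "cos (\<theta> b) \<le> cos (\<theta> v)" if "\<theta> v \<le> 0"
      using that \<open>\<theta> b \<le> \<theta> v\<close> range[of b] cos_monotone_0_pi_le[of "- \<theta> v" "- \<theta> b"] by simp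
    ultimately have "cos (\<theta> v) \<ge> cos (\<theta> a) \<or> cos (\<theta> v) \<ge> cos (\<theta> b)"
      by linarith
    then have "r * cos (\<theta> v) \<ge> r * cos (\<theta> a) \<or> r * cos (\<theta> v) \<ge> r * cos (\<theta> b)"
      using \<open>r > 0\<close> by simp
    with \<open>0 < g a\<close> \<open>0 < g b\<close> show ?thesis
      unfolding g X by auto
  qed
  have reflected: "\<theta> (a + b - v) = \<theta> a + \<theta> b - \<theta> v" if "v \<in> K" for v
  proof -
    have "X v \<noteq> 0"
      by (simp add: X)
    have "cis (\<theta> a + \<theta> b - \<theta> v) * X v = X (a + b - v) * X v"
      unfolding mult by (simp add: X cis_mult)
    then have "X (a + b - v) = cis (\<theta> a + \<theta> b - \<theta> v)"
      using \<open>X v \<noteq> 0\<close> by simp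
    \<comment> \<open>The reflected angle lies between the extremal angles, so no multiple of
      \<open>2 * pi\<close> intervenes.\<close>
    moreover have "\<theta> a + \<theta> b - \<theta> v \<in> {- pi<..pi}"
      using bounds[OF that] range[of a] range[of b] by auto
    ultimately show ?thesis
      by (simp add: \<theta>_def[of "a + b - v"] Arg_cis)
  qed
  have reflected_positive: "0 < g (a + b - v)" if "v \<in> K" for v
    using bounds[OF that] by (intro positive) (simp_all add: reflected[OF that])
  have "a + b - v \<in> K" if "v \<in> K" for v
  proof -
    have "v \<in> component g a"
      using component_joined a(1) that unfolding K_def by blast
    then have "v \<in> K \<and> a + b - v \<in> K"
    proof (induction rule: component_induct)
      case base
      then show ?case using a(1) b(1) by simp
    next
      case (step u v)
      have "v \<in> K"
        using component_step step unfolding K_def by blast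
      moreover have "adj (a + b - u) (a + b - v)"
        using \<open>adj u v\<close> by (rule adj_turned)
      ultimately show ?case
        using component_step[of "a + b - u" g v0 "a + b - v"] step reflected_positive
        unfolding K_def by blast
    qed
    then show ?thesis ..
  qed
  then show ?thesis
    unfolding centrally_symmetric_def K_def by blast
qed

section \<open>Periods of bi-infinite words\<close>

lemma int_periodic:
  fixes w :: "int \<Rightarrow> 'a" and p k :: int
  assumes "\<And>i. w (i + p) = w i"
  shows "w (i + k * p) = w i"
proof (induction k rule: int_induct[of _ 0])
  case (step1 k)
  then show ?case
    using assms[of "i + k * p"] by (simp add: algebra_simps)
next
  case (step2 k)
  then show ?case
    using assms[of "i + (k - 1) * p"] by (simp add: algebra_simps)
qed simp

lemma int_periodic_mod:
  fixes w :: "int \<Rightarrow> 'a" and p :: int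
  assumes "\<And>i. w (i + p) = w i"
  shows "w (i mod p) = w i"
  using int_periodic[of w p "i mod p" "i div p"] assms by (simp add: algebra_simps)

lemma periodic_word_of_period:
  fixes w :: "int \<Rightarrow> 'a" and p :: nat
  assumes "p > 0" "\<And>i. w (i + int p) = w i"
  shows "w = periodic_word (map (\<lambda>k. w (int k)) [0..<p])"
proof
  fix i
  have "0 \<le> i mod int p" "i mod int p < int p"
    using assms(1) by simp_all
  then show "w i = periodic_word (map (\<lambda>k. w (int k)) [0..<p]) i"
    using int_periodic_mod[of w "int p" i] assms by (simp add: periodic_word_def nat_less_iff)
qed

text \<open>Division with remainder: \<open>q mod int m\<close> is again a period, below the least
  positive one. An integer \<open>q\<close> is allowed because the shift given by a symmetry may be
  negative.\<close>

lemma minimal_period_dvd: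
  fixes w :: "int \<Rightarrow> 'a" and p :: nat
  assumes p: "p > 0" "\<And>i. w (i + int p) = w i"
  defines "m \<equiv> length (minimal_period w)"
  shows "m > 0" "w (i + int m) = w i" "(\<And>i. w (i + q) = w i) \<Longrightarrow> int m dvd q"
proof -
  define P where "P = (\<lambda>s. s \<noteq> [] \<and> w = periodic_word s)"
  have word: "P (map (\<lambda>k. w (int k)) [0..<n])" if "n > 0" "\<And>i. w (i + int n) = w i" for n
    using periodic_word_of_period[of n w] that by (simp add: P_def)
  have min: "minimal_period w = arg_min length P"
    by (simp add: minimal_period_def P_def)
  have "P (minimal_period w)"
    unfolding min using arg_min_natI[of P, OF word[OF p]] by simp
  then show pos: "m > 0" and per: "w (i + int m) = w i" for i
    by (auto simp: P_def m_def) (metis mod_add_self2 periodic_word_def)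
  have least: "m \<le> n" if "n > 0" "\<And>i. w (i + int n) = w i" for n
    using arg_min_nat_le[of P, OF word[OF that], of length] by (simp add: m_def min)
  assume q: "\<And>i. w (i + q) = w i"
  have "w (i + q mod int m) = w i" for i
  proof -
    have "w (i + q mod int m) = w (i + q mod int m + (q div int m) * int m)"
      using int_periodic[of w "int m"] per by metis
    also have "\<dots> = w (i + q)"
      by (simp add: algebra_simps)
    finally show ?thesis by (simp add: q)
  qed
  moreover have "0 \<le> q mod int m" "q mod int m < int m"
    using pos by simp_all
  ultimately have "q mod int m = 0"
    using least[of "nat (q mod int m)"] by (cases "q mod int m = 0") auto
  then show "int m dvd q" by auto
qed

section \<open>Refraction and barycentric coordinates\<close>

lemma refract_eq:
  assumes "e \<noteq> 0"
  shows "refract e u = - cnj u * e / cnj e"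
proof -
  have "complex_of_real (2 * (u \<bullet> e)) = u * cnj e + cnj u * e"
    by (simp add: inner_complex_def complex_eq_iff)
  moreover have "complex_of_real (e \<bullet> e) = e * cnj e"
    by (simp add: inner_complex_def complex_eq_iff)
  ultimately have "complex_of_real (2 * (u \<bullet> e) / (e \<bullet> e)) = (u * cnj e + cnj u * e) / (e * cnj e)"
    by (metis of_real_divide)
  then show ?thesis
    using assms by (simp add: refract_def scaleR_conv_of_real field_simps)
qed

lemma refract_uminus: "refract (- e) u = refract e u"
  by (simp add: refract_def)

text \<open>Twice the signed area of the triangle.\<close>

definition cross :: "triangle \<Rightarrow> real" where
  "cross T = Im (cnj (T A - T C) * (T B - T C))"

lemma range_triangle: "range (T :: triangle) = {T A, T B, T C}"
proof -
  have "UNIV = {A, B, C}"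
    using side.exhaust by blast
  then show ?thesis by (metis image_empty image_insert)
qed

lemma collinear_range_iff: "collinear (range T) \<longleftrightarrow> cross T = 0"
proof -
  have "range T = {T A, T C, T B}"
    unfolding range_triangle by blast
  then have "collinear (range T) \<longleftrightarrow> (T B - T C) / (T A - T C) \<in> \<real>"
    by (simp add: collinear_3 collinear_iff_Reals)
  also have "\<dots> \<longleftrightarrow> cross T = 0"
    by (simp add: cross_def complex_is_Real_iff Im_divide field_simps complex_eq_iff
        flip: power2_eq_square)
      (auto simp: sum_power2_eq_zero_iff algebra_simps)
  finally show ?thesis .
qed

lemma circumcircle:
  fixes T :: triangle
  assumes "cross T \<noteq> 0"
  obtains P r where "r > 0" "\<And>k. cmod (T k - P) = r"
proof -
  define p q where "p = T A - T C" and "q = T B - T C"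
  define D where "D = cross T"
  have D: "D = Re p * Im q - Im p * Re q"
    by (simp add: D_def cross_def p_def q_def algebra_simps)
  \<comment> \<open>Cramer's rule for the equations of equidistance, with \<open>T C\<close> moved
    to the origin.\<close>
  define m where "m = Complex (((cmod p)\<^sup>2 * Im q - (cmod q)\<^sup>2 * Im p) / (2 * D))
                              (((cmod q)\<^sup>2 * Re p - (cmod p)\<^sup>2 * Re q) / (2 * D))"
  have eq: "(cmod (z - m))\<^sup>2 = (cmod m)\<^sup>2 \<longleftrightarrow> 2 * (Re m * Re z + Im m * Im z) = (cmod z)\<^sup>2" for z
    unfolding cmod_power2 by (auto simp: power2_eq_square algebra_simps)
  have mp: "2 * (Re m * Re p + Im m * Im p) = (cmod p)\<^sup>2"
  proof -
    have "2 * (Re m * Re p + Im m * Im p) = (cmod p)\<^sup>2 * (Re p * Im q - Im p * Re q) / D"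
      using assms by (simp add: m_def D_def[symmetric] field_simps)
    then show ?thesis using assms by (simp add: D[symmetric] D_def[symmetric])
  qed
  have mq: "2 * (Re m * Re q + Im m * Im q) = (cmod q)\<^sup>2"
  proof -
    have "2 * (Re m * Re q + Im m * Im q) = (cmod q)\<^sup>2 * (Re p * Im q - Im p * Re q) / D"
      using assms by (simp add: m_def D_def[symmetric] field_simps)
    then show ?thesis using assms by (simp add: D[symmetric] D_def[symmetric])
  qed
  have "cmod (p - m) = cmod m" "cmod (q - m) = cmod m"
    using eq mp mq by (metis norm_ge_zero power2_eq_imp_eq)+
  moreover have "m \<noteq> 0"
  proof
    assume "m = 0"
    then have "p = 0" using mp by simp
    then show False using assms D by (simp add: D_def[symmetric])
  qed
  ultimately show thesis
  proof (intro that[of "cmod m" "T C + m"])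
    fix k assume *: "cmod (p - m) = cmod m" "cmod (q - m) = cmod m"
    then show "cmod (T k - (T C + m)) = cmod m"
      by (cases k) (simp_all add: p_def q_def algebra_simps)
  qed simp
qed

definition comb :: "triangle \<Rightarrow> (side \<Rightarrow> real) \<Rightarrow> complex" where
  "comb T \<beta> = \<beta> A *\<^sub>R T A + \<beta> B *\<^sub>R T B + \<beta> C *\<^sub>R T C"

lemma cross_independent:
  assumes "cross T \<noteq> 0" "x *\<^sub>R (T A - T C) + y *\<^sub>R (T B - T C) = 0"
  shows "x = 0" "y = 0"
proof -
  let ?p = "T A - T C" and ?q = "T B - T C"
  have re: "x * Re ?p + y * Re ?q = 0" and im: "x * Im ?p + y * Im ?q = 0"
    using arg_cong[OF assms(2), of Re] arg_cong[OF assms(2), of Im] by simp_all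
  have D: "cross T = Re ?p * Im ?q - Im ?p * Re ?q"
    by (simp add: cross_def algebra_simps)
  have "x * cross T = (x * Re ?p + y * Re ?q) * Im ?q - (x * Im ?p + y * Im ?q) * Re ?q"
    unfolding D by (simp only: algebra_simps)
  then show "x = 0" using assms(1) unfolding re im by simp
  have "y * cross T = (x * Im ?p + y * Im ?q) * Re ?p - (x * Re ?p + y * Re ?q) * Im ?p"
    unfolding D by (simp only: algebra_simps)
  then show "y = 0" using assms(1) unfolding re im by simp
qed

lemma comb_unique:
  assumes "cross T \<noteq> 0" "comb T \<beta> = comb T \<gamma>"
    and "\<beta> A + \<beta> B + \<beta> C = 1" "\<gamma> A + \<gamma> B + \<gamma> C = 1"
  shows "\<beta> k = \<gamma> k"
proof -
  have c: "\<beta> C = 1 - \<beta> A - \<beta> B" "\<gamma> C = 1 - \<gamma> A - \<gamma> B"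
    using assms(3,4) by linarith+
  have "(\<beta> A - \<gamma> A) *\<^sub>R (T A - T C) + (\<beta> B - \<gamma> B) *\<^sub>R (T B - T C) = comb T \<beta> - comb T \<gamma>"
    unfolding comb_def c by (simp add: algebra_simps)
  also have "\<dots> = 0"
    using assms(2) by simp
  finally have "\<beta> A - \<gamma> A = 0" "\<beta> B - \<gamma> B = 0"
    by (rule cross_independent[OF assms(1)])+
  then show ?thesis
    using c by (cases k) simp_all
qed

lemma tile_interior_comb:
  assumes "cross T \<noteq> 0" "p \<in> tile_interior T"
  obtains \<beta> where "\<And>k. \<beta> k > 0" "\<beta> A + \<beta> B + \<beta> C = 1" "p = comb T \<beta>"
proof -
  have "\<not> collinear {T A, T B, T C}"
    using assms(1) collinear_range_iff unfolding range_triangle by blast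
  then obtain x y z where xyz: "0 < x" "0 < y" "0 < z" "x + y + z = 1"
    "x *\<^sub>R T A + y *\<^sub>R T B + z *\<^sub>R T C = p"
    using assms(2) interior_convex_hull_3_minimal[of "T A" "T B" "T C"] DIM_complex
    unfolding tile_interior_def range_triangle by auto
  show thesis
  proof (rule that[of "case_side x y z"])
    show "case_side x y z k > 0" for k :: side
      using xyz by (cases k) simp_all
  qed (use xyz in \<open>simp_all add: comb_def\<close>)
qed

text \<open>Barycentric coordinates of the point at fraction \<open>a\<close> of the way from the
  \<open>nxt\<close> end to the \<open>prv\<close> end of side \<open>l\<close>.\<close>

definition on_side :: "side \<Rightarrow> real \<Rightarrow> side \<Rightarrow> real" where
  "on_side l a k = (if k = l then 0 else if k = nxt l then 1 - a else a)"

lemma on_side_sum: "on_side l a A + on_side l a B + on_side l a C = 1"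
  by (cases l) (simp_all add: on_side_def)

lemma on_side_simps [simp]:
  "on_side l a l = 0" "on_side l a (nxt l) = 1 - a" "on_side l a (prv l) = a"
  by (simp_all add: on_side_def)

lemma comb_on_side: "comb T (on_side l a) = (1 - a) *\<^sub>R T (nxt l) + a *\<^sub>R T (prv l)"
  by (cases l) (simp_all add: comb_def on_side_def)

lemma open_side_comb:
  assumes "p \<in> open_side T l"
  obtains a where "0 < a" "a < 1" "p = comb T (on_side l a)"
  using assms unfolding open_side_def side_ends_nxt_prv comb_on_side
  by (auto simp: in_segment)

section \<open>The folded tiling\<close>

locale developed_tiling =
  fixes \<Delta> :: triangle and P :: complex and r :: real
  assumes r_pos: "r > 0" and on_circle: "cmod (\<Delta> k - P) = r"
    and nondegenerate: "cross \<Delta> \<noteq> 0"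
begin

definition U :: "side \<Rightarrow> complex" where
  "U k = \<Delta> k - P"

lemma U_nonzero [simp]: "U k \<noteq> 0"
  using on_circle[of k] r_pos by (auto simp: U_def)

lemma cnj_U: "cnj (U k) = (complex_of_real r)\<^sup>2 / U k"
proof -
  have "U k * cnj (U k) = (complex_of_real r)\<^sup>2"
    using complex_norm_square[of "U k"] on_circle[of k] by (simp add: U_def)
  then show ?thesis
    using U_nonzero[of k] by (simp add: field_simps)
qed

definition pos :: "vertex \<Rightarrow> complex" where
  "pos z = \<Delta> C + real_of_int (fst z) *\<^sub>R (\<Delta> A - \<Delta> C) + real_of_int (snd z) *\<^sub>R (\<Delta> B - \<Delta> C)"

text \<open>On a circle about 0, reflection in the bisector of the chord from \<open>b\<close> to
  \<open>c\<close> sends \<open>a\<close> to \<open>b * c / a\<close>, while the lattice vertex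
  opposite to \<open>a\<close> is \<open>b + c - a\<close>. So folding turns sums into
  products.\<close>

definition character :: "vertex \<Rightarrow> complex" where
  "character z = (U A / U C) powi fst z * (U B / U C) powi snd z"

lemma character_nonzero [simp]: "character z \<noteq> 0"
  by (simp add: character_def)

lemma character_add: "character (y + z) = character y * character z"
  by (simp add: character_def power_int_add)

lemma character_diff: "character (y - z) = character y / character z"
  by (simp add: character_def power_int_diff)

lemma character_corner: "character (corner k) = U k / U C"
  by (cases k) (simp_all add: character_def)

lemma norm_character: "cmod (character z) = 1"
  using on_circle r_pos by (simp add: character_def norm_mult norm_power_int norm_divide U_def)

lemma pos_add: "pos (x + y - z) = pos x + pos y - pos z"
  by (simp add: pos_def algebra_simps)

lemma pos_plus_corner: "pos (z + corner k) = pos z + (U k - U C)"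
  by (cases k) (simp_all add: pos_def U_def algebra_simps)

lemma pos_minus_corner: "pos (z - corner k) = pos z - (U k - U C)"
  by (cases k) (simp_all add: pos_def U_def algebra_simps)

definition realize :: "cell \<Rightarrow> triangle" where
  "realize t k = pos (vert t k)"

lemma realize_simps:
  "realize (True, z) k = pos z + (U k - U C)" "realize (False, z) k = pos z - (U k - U C)"
  by (simp_all add: realize_def vert.simps pos_plus_corner pos_minus_corner)

lemma realize_base: "realize (True, 0) = \<Delta>"
  by (rule ext) (simp add: realize_simps pos_def U_def)

lemma neighbour_realize: "neighbour (realize t) l = realize (flip t l)"
proof
  fix k
  show "neighbour (realize t) l k = realize (flip t l) k"
    by (simp add: neighbour_def central_symmetry_def side_ends_nxt_prv realize_def vert_flip
        pos_add midpoint_def)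
qed

lemma tiling_realize: "T \<in> tiling \<Delta> \<Longrightarrow> \<exists>t. T = realize t"
proof (induction rule: tiling.induct)
  case base
  show ?case using realize_base by metis
next
  case (neighbour T l)
  then show ?case using neighbour_realize by metis
qed

lemma cross_realize: "cross (realize t) = cross \<Delta>"
proof -
  obtain s z where t: "t = (s, z)" by (cases t)
  have d: "U A - U C = \<Delta> A - \<Delta> C" "U B - U C = \<Delta> B - \<Delta> C"
    by (simp_all add: U_def)
  have diff: "realize t k - realize t C = (if s then U k - U C else - (U k - U C))" for k
    unfolding t by (cases s) (simp_all add: realize_simps)
  then show ?thesis
    unfolding cross_def d[symmetric] diff by (cases s) (simp_all add: algebra_simps)
qed

lemma comb_realize:
  assumes "\<beta> A + \<beta> B + \<beta> C = 1"
  shows "comb (realize (s, z)) \<beta> = pos z + (if s then 1 else - 1) *\<^sub>R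
    (\<beta> A *\<^sub>R (\<Delta> A - \<Delta> C) + \<beta> B *\<^sub>R (\<Delta> B - \<Delta> C))"
proof -
  have c: "\<beta> C = 1 - \<beta> A - \<beta> B"
    using assms by linarith
  show ?thesis
    unfolding comb_def c by (cases s) (simp_all add: realize_simps U_def algebra_simps)
qed

text \<open>For equal orientations the integer coordinates differ by less than 1. For opposite ones
  both differences would, up to a common sign, be positive integers with sum below 2.\<close>

lemma interiors_disjoint:
  assumes "p \<in> tile_interior (realize t)" "p \<in> tile_interior (realize t')"
  shows "t = t'"
proof -
  obtain s x y s' x' y' where t: "t = (s, x, y)" and t': "t' = (s', x', y')"
    by (metis surj_pair)
  have nd: "cross (realize u) \<noteq> 0" for u
    using nondegenerate cross_realize by simp
  obtain \<beta> where \<beta>: "\<And>k. \<beta> k > 0" "\<beta> A + \<beta> B + \<beta> C = 1" "p = comb (realize t) \<beta>"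
    using tile_interior_comb[OF nd assms(1)] by blast
  obtain \<gamma> where \<gamma>: "\<And>k. \<gamma> k > 0" "\<gamma> A + \<gamma> B + \<gamma> C = 1" "p = comb (realize t') \<gamma>"
    using tile_interior_comb[OF nd assms(2)] by blast
  define \<epsilon> \<epsilon>' :: real where "\<epsilon> = (if s then 1 else - 1)" and "\<epsilon>' = (if s' then 1 else - 1)"
  have "comb (realize t) \<beta> - comb (realize t') \<gamma> = 0"
    using \<beta>(3) \<gamma>(3) by simp
  then have "(x + \<epsilon> * \<beta> A - (x' + \<epsilon>' * \<gamma> A)) *\<^sub>R (\<Delta> A - \<Delta> C) +
      (y + \<epsilon> * \<beta> B - (y' + \<epsilon>' * \<gamma> B)) *\<^sub>R (\<Delta> B - \<Delta> C) = 0"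
    unfolding t t' comb_realize[OF \<beta>(2)] comb_realize[OF \<gamma>(2)] pos_def
      \<epsilon>_def[symmetric] \<epsilon>'_def[symmetric]
    by (simp add: algebra_simps)
  from cross_independent[OF nondegenerate this]
  have eq: "x + \<epsilon> * \<beta> A = x' + \<epsilon>' * \<gamma> A" "y + \<epsilon> * \<beta> B = y' + \<epsilon>' * \<gamma> B"
    by simp_all
  have bounds: "0 < \<beta> A" "0 < \<beta> B" "\<beta> A + \<beta> B < 1" "0 < \<gamma> A" "0 < \<gamma> B" "\<gamma> A + \<gamma> B < 1"
    using \<beta>(1)[of A] \<beta>(1)[of B] \<beta>(1)[of C] \<beta>(2) \<gamma>(1)[of A] \<gamma>(1)[of B] \<gamma>(1)[of C] \<gamma>(2)
    by linarith+
  consider "s = s'" | "s" "\<not> s'" | "\<not> s" "s'" by blast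
  then show ?thesis
  proof cases
    case 1
    then have "\<bar>real_of_int (x - x')\<bar> < 1" "\<bar>real_of_int (y - y')\<bar> < 1"
      using eq bounds unfolding \<epsilon>_def \<epsilon>'_def by (auto split: if_splits)
    then have "x = x'" "y = y'" by linarith+
    then show ?thesis using 1 by (simp add: t t')
  next
    case 2
    then have "real_of_int (x' - x) = \<beta> A + \<gamma> A" "real_of_int (y' - y) = \<beta> B + \<gamma> B"
      using eq by (simp_all add: \<epsilon>_def \<epsilon>'_def)
    then have "real_of_int (x' - x) > 0" "real_of_int (y' - y) > 0"
      "real_of_int (x' - x + (y' - y)) < 2"
      unfolding of_int_add using bounds by linarith+
    then show ?thesis
      unfolding of_int_0_less_iff of_int_less_numeral_iff by linarith
  next
    case 3
    then have "real_of_int (x - x') = \<beta> A + \<gamma> A" "real_of_int (y - y') = \<beta> B + \<gamma> B"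
      using eq by (simp_all add: \<epsilon>_def \<epsilon>'_def)
    then have "real_of_int (x - x') > 0" "real_of_int (y - y') > 0"
      "real_of_int (x - x' + (y - y')) < 2"
      unfolding of_int_add using bounds by linarith+
    then show ?thesis
      unfolding of_int_0_less_iff of_int_less_numeral_iff by linarith
  qed
qed

lemma pos_inj: "pos y = pos z \<Longrightarrow> y = z"
proof -
  assume "pos y = pos z"
  then have "real_of_int (fst y - fst z) *\<^sub>R (\<Delta> A - \<Delta> C) +
      real_of_int (snd y - snd z) *\<^sub>R (\<Delta> B - \<Delta> C) = 0"
    by (simp add: pos_def algebra_simps)
  from cross_independent[OF nondegenerate this] show "y = z"
    by (simp add: prod_eq_iff)
qed

lemma realize_inj:
  assumes "realize t = realize t'"
  shows "t = t'"
  using fun_cong[OF assms] by (intro cell_eqI pos_inj) (simp add: realize_def)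

section \<open>The folding map\<close>

definition image_on_circle :: "vertex \<Rightarrow> complex" where
  "image_on_circle z = U C * character z"

text \<open>The linear part of the folding, except that the factor -1 on inverted cells is left to
  \<open>fold_point\<close>. The folded particle turns back at every crossing; with this factor
  removed its direction is constant.\<close>

definition fold_direction :: "cell \<Rightarrow> complex \<Rightarrow> complex" where
  "fold_direction t d = (if fst t then character (snd t) * d
     else character (snd t) * (U C)\<^sup>2 / (complex_of_real r)\<^sup>2 * cnj d)"

definition fold_point :: "cell \<Rightarrow> complex \<Rightarrow> complex" where
  "fold_point t p = character (snd t) * U C +
     (if fst t then 1 else - 1) * fold_direction t (p - pos (snd t))"

lemma fold_direction_add: "fold_direction t (x + y) = fold_direction t x + fold_direction t y"
  by (simp add: fold_direction_def algebra_simps add_divide_distrib)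

lemma fold_direction_scale: "fold_direction t (a *\<^sub>R x) = a *\<^sub>R fold_direction t x"
  by (simp add: fold_direction_def scaleR_conv_of_real)

lemma fold_point_shift:
  "fold_point t (p + a *\<^sub>R d) = fold_point t p + (if fst t then a else - a) *\<^sub>R fold_direction t d"
proof -
  have "p + a *\<^sub>R d - pos (snd t) = (p - pos (snd t)) + a *\<^sub>R d" by simp
  then have "fold_direction t (p + a *\<^sub>R d - pos (snd t)) =
      fold_direction t (p - pos (snd t)) + a *\<^sub>R fold_direction t d"
    by (simp only: fold_direction_add fold_direction_scale)
  then show ?thesis
    unfolding fold_point_def by (simp add: algebra_simps)
qed

lemma fold_point_vert: "fold_point t (realize t k) = image_on_circle (vert t k)"
proof -
  obtain s z where t: "t = (s, z)" by (cases t)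
  show ?thesis
    unfolding t using r_pos
    by (cases s) (simp_all add: fold_point_def fold_direction_def realize_simps image_on_circle_def
        vert.simps character_add character_diff character_corner cnj_U field_simps power2_eq_square)
qed

lemma fold_point_comb:
  assumes "\<beta> A + \<beta> B + \<beta> C = 1"
  shows "fold_point t (comb (realize t) \<beta>) = comb (\<lambda>k. image_on_circle (vert t k)) \<beta>"
proof -
  have c: "\<beta> C = 1 - \<beta> A - \<beta> B"
    using assms by linarith
  define p where "p k = realize t k - realize t C" for k
  have eq: "comb (realize t) \<beta> = realize t C + \<beta> A *\<^sub>R p A + \<beta> B *\<^sub>R p B"
    unfolding comb_def c by (simp add: p_def algebra_simps)
  have diff: "(if fst t then a else - a) *\<^sub>R fold_direction t (p k) =
      a *\<^sub>R (fold_point t (realize t k) - fold_point t (realize t C))" for k a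
    using fold_point_shift[of t "realize t C" 1 "p k"]
    by (cases "fst t") (simp_all add: p_def)
  show ?thesis
    unfolding eq fold_point_shift diff fold_point_vert
    unfolding comb_def c by (simp add: algebra_simps)
qed

text \<open>For a chord from \<open>b\<close> to \<open>c\<close> of a circle about 0,
  \<open>cnj (c - b)\<close> is \<open>- r^2 * (c - b) / (b * c)\<close>, so refraction is
  conjugation times \<open>b * c / r^2\<close>. The change of \<open>character\<close> between the
  cells compensates this factor.\<close>

lemma fold_direction_refract:
  "fold_direction (flip t l) (refract (side_vector (realize t) l) u) = fold_direction t u"
proof -
  obtain s z where t: "t = (s, z)" by (cases t)
  define b c where "b = U (nxt l)" and "c = U (prv l)"
  have "realize t (prv l) \<noteq> realize t (nxt l)"
  proof
    assume "realize t (prv l) = realize t (nxt l)"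
    then have "cross (realize t) = 0"
      by (cases l) (simp_all add: cross_def algebra_simps)
    then show False using nondegenerate cross_realize by simp
  qed
  then have "b \<noteq> c"
    unfolding t b_def c_def by (cases s) (auto simp: realize_simps)
  have nz: "b \<noteq> 0" "c \<noteq> 0" "complex_of_real r \<noteq> 0"
    using r_pos by (simp_all add: b_def c_def)
  have "side_vector (realize t) l = c - b \<or> side_vector (realize t) l = - (c - b)"
    unfolding t by (cases s) (simp_all add: side_vector_def side_ends_nxt_prv realize_simps b_def c_def)
  then have "refract (side_vector (realize t) l) u = refract (c - b) u"
    by (metis refract_uminus)
  also have "\<dots> = - cnj u * (c - b) / cnj (c - b)"
    using \<open>b \<noteq> c\<close> by (intro refract_eq) simp
  also have "cnj (c - b) = - (complex_of_real r)\<^sup>2 * (c - b) / (b * c)"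
    using nz by (simp add: b_def c_def cnj_U field_simps)
  also have "- cnj u * (c - b) / (- (complex_of_real r)\<^sup>2 * (c - b) / (b * c)) =
      cnj u * (b * c) / (complex_of_real r)\<^sup>2"
    using nz \<open>b \<noteq> c\<close> by (simp add: field_simps)
  finally have refr: "refract (side_vector (realize t) l) u = cnj u * (b * c) / (complex_of_real r)\<^sup>2" .
  have cnj_bc: "cnj b = (complex_of_real r)\<^sup>2 / b" "cnj c = (complex_of_real r)\<^sup>2 / c"
    by (simp_all add: b_def c_def cnj_U)
  have q: "character (z + (corner (nxt l) + corner (prv l))) = character z * (b * c) / (U C)\<^sup>2"
    "character (z - (corner (nxt l) + corner (prv l))) = character z * (U C)\<^sup>2 / (b * c)"
    by (simp_all add: character_add character_diff character_corner b_def c_def power2_eq_square)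
  show ?thesis
    unfolding refr unfolding t
    by (cases s) (use nz in \<open>simp_all add: fold_direction_def flip.simps q cnj_bc field_simps power2_eq_square\<close>)
qed

lemma norm_fold_direction: "cmod (fold_direction t d) = cmod d"
proof -
  have "cmod (U C) = r" using on_circle by (simp add: U_def)
  then show ?thesis
    using r_pos by (simp add: fold_direction_def norm_mult norm_divide norm_character norm_power)
qed

text \<open>Folding is an isometry on each cell, so the folded tile is a nondegenerate triangle and
  no line of direction \<open>\<kappa>\<close> contains it.\<close>

lemma image_not_on_line:
  assumes "\<kappa> \<noteq> 0"
  shows "\<exists>k. Im (cnj \<kappa> * image_on_circle (vert t k)) \<noteq> c"
proof (rule ccontr)
  assume "\<not> ?thesis"
  then have *: "Im (cnj \<kappa> * (image_on_circle (vert t k) - image_on_circle (vert t C))) = 0" for k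
    by (simp add: right_diff_distrib)
  define \<rho> where "\<rho> = cnj \<kappa> * fold_direction t 1"
  have "\<rho> \<noteq> 0"
    using assms norm_fold_direction[of t 1] by (auto simp: \<rho>_def)
  define p where "p k = realize t k - realize t C" for k
  have "image_on_circle (vert t k) - image_on_circle (vert t C) =
      (if fst t then 1 else - 1) *\<^sub>R fold_direction t (p k)" for k
    using fold_point_shift[of t "realize t C" 1 "p k"] fold_point_vert
    by (cases "fst t") (simp_all add: p_def)
  then have "Im (cnj \<kappa> * fold_direction t (p k)) = 0" for k
    using *[of k] by (cases "fst t") simp_all
  moreover have "cnj \<kappa> * fold_direction t d = \<rho> * (if fst t then d else cnj d)" for d
    by (simp add: \<rho>_def fold_direction_def)
  ultimately have real: "Im (\<rho> * (if fst t then p k else cnj (p k))) = 0" for k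
    by simp
  define q where "q k = (if fst t then p k else cnj (p k))" for k
  have "(cmod \<rho>)\<^sup>2 * Im (cnj (q A) * q B) = Im (cnj (\<rho> * q A) * (\<rho> * q B))"
    unfolding cmod_power2 by (simp add: power2_eq_square algebra_simps)
  also have "\<dots> = 0"
    using real[of A] real[of B] unfolding q_def[symmetric] by simp
  finally have "Im (cnj (q A) * q B) = 0"
    using \<open>\<rho> \<noteq> 0\<close> by simp
  moreover have "Im (cnj (q A) * q B) = (if fst t then 1 else - 1) * cross (realize t)"
    by (simp add: q_def p_def cross_def algebra_simps)
  ultimately show False
    using nondegenerate cross_realize by (simp split: if_splits)
qed

lemma cross_realize_nonzero: "cross (realize t) \<noteq> 0"
  using nondegenerate cross_realize by simp

section \<open>Coding and period of a closed trajectory\<close>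

lemma period_of_closed_trajectory:
  fixes \<delta> :: path
  assumes traj: "trajectory \<Delta> \<delta>" and closed: "closed_trajectory \<delta>"
  shows "odd (length (minimal_period (coding \<delta>))) \<and> (\<exists>n::nat. n \<ge> 1 \<and> period \<delta> = 4 * n + 2)"
proof -
  define p where "p = point \<delta>"
  define l where "l = coding \<delta>"
  have tr: "tile \<delta> i \<in> tiling \<Delta>" "p i \<noteq> p (i + 1)"
    "open_segment (p i) (p (i + 1)) \<subseteq> tile_interior (tile \<delta> i)"
    "p i \<in> open_side (tile \<delta> i) (l i)"
    "p (i + 1) \<in> open_side (tile \<delta> i) (l (i + 1))"
    "tile \<delta> (i + 1) = neighbour (tile \<delta> i) (l (i + 1))"
    "direction \<delta> (i + 1) = refract (side_vector (tile \<delta> i) (l (i + 1))) (direction \<delta> i)" for i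
    using traj unfolding trajectory_def p_def l_def by blast+
  have "\<exists>t. \<forall>i. tile \<delta> i = realize (t i)"
    using tiling_realize[OF tr(1)] by (intro choice) blast
  then obtain t where t: "\<And>i. tile \<delta> i = realize (t i)"
    by blast
  have step: "t (i + 1) = flip (t i) (l (i + 1))" for i
    by (rule realize_inj) (use tr(6)[of i] in \<open>simp add: t neighbour_realize\<close>)
  have "p i \<in> open_side (realize (t i)) (l i)" for i
    using tr(4)[of i] by (simp add: t)
  then have "\<exists>a. \<forall>i. 0 < a i \<and> a i < 1 \<and> p i = comb (realize (t i)) (on_side (l i) (a i))"
    by (intro choice) (metis open_side_comb)
  then obtain a where a: "\<And>i. 0 < a i" "\<And>i. a i < 1"
    "\<And>i. p i = comb (realize (t i)) (on_side (l i) (a i))"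
    by blast
  \<comment> \<open>The central symmetry swaps the ends of the common side, hence
    \<open>1 - a (i + 1)\<close>.\<close>
  have p_exit: "p (i + 1) = comb (realize (t i)) (on_side (l (i + 1)) (1 - a (i + 1)))" for i
    unfolding a(3) comb_on_side step by (simp add: realize_def vert_flip)

  define \<kappa> where "\<kappa> = fold_direction (t 0) (direction \<delta> 0)"
  have direction: "fold_direction (t i) (direction \<delta> i) = \<kappa>" for i
  proof (rule int_shift_invariant[of "\<lambda>i. fold_direction (t i) (direction \<delta> i) = \<kappa>" 0])
    show "fold_direction (t 0) (direction \<delta> 0) = \<kappa>" by (simp add: \<kappa>_def)
    show "(fold_direction (t i) (direction \<delta> i) = \<kappa>) =
        (fold_direction (t (i + 1)) (direction \<delta> (i + 1)) = \<kappa>)" for i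
      using fold_direction_refract[of "t i" "l (i + 1)" "direction \<delta> i"] tr(7)[of i]
      by (simp add: t step)
  qed
  have "cmod (direction \<delta> i) = 1" for i
    using tr(2)[of i] by (simp add: direction_def p_def norm_sgn)
  then have \<kappa>: "cmod \<kappa> = 1"
    by (simp add: \<kappa>_def norm_fold_direction)
  then have "\<kappa> \<noteq> 0" by auto
  \<comment> \<open>The level sets are the lines of direction \<open>\<kappa>\<close>, along which
    the folded particle moves.\<close>
  define height where "height z = Im (cnj \<kappa> * z)" for z
  have height_comb: "height (comb T \<beta>) = \<beta> A * height (T A) + \<beta> B * height (T B) + \<beta> C * height (T C)" for T \<beta>
    by (simp add: height_def comb_def algebra_simps)
  have height_linear: "height (x + b *\<^sub>R (y - z)) = height x + b * (height y - height z)" for x y z b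
    by (simp add: height_def algebra_simps)
  have height_along: "height (fold_point (t i) (p (i + 1))) = height (fold_point (t i) (p i))" for i
  proof -
    define d where "d = cmod (p (i + 1) - p i)"
    have "p (i + 1) = p i + d *\<^sub>R direction \<delta> i"
      using tr(2)[of i] by (simp add: d_def direction_def p_def sgn_div_norm)
    then have "fold_point (t i) (p (i + 1)) =
        fold_point (t i) (p i) + (if fst (t i) then d else - d) *\<^sub>R \<kappa>"
      using fold_point_shift direction by metis
    moreover have "Im (cnj \<kappa> * \<kappa>) = 0" by simp
    ultimately show ?thesis
      by (simp add: height_def distrib_left)
  qed
  have fold_entry: "fold_point (t i) (p i) =
      comb (\<lambda>k. image_on_circle (vert (t i) k)) (on_side (l i) (a i))" for i
    unfolding a(3) using fold_point_comb on_side_sum by blast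
  have fold_exit: "fold_point (t i) (p (i + 1)) = fold_point (t (i + 1)) (p (i + 1))" for i
  proof -
    have "fold_point (t i) (p (i + 1)) =
        comb (\<lambda>k. image_on_circle (vert (t i) k)) (on_side (l (i + 1)) (1 - a (i + 1)))"
      unfolding p_exit using fold_point_comb on_side_sum by blast
    then show ?thesis
      using fold_entry[of "i + 1"] by (simp add: comb_on_side step vert_flip)
  qed
  define c where "c = height (fold_point (t 0) (p 0))"
  have height_const: "height (fold_point (t i) (p i)) = c" for i
  proof (rule int_shift_invariant[of "\<lambda>i. height (fold_point (t i) (p i)) = c" 0])
    show "(height (fold_point (t i) (p i)) = c) = (height (fold_point (t (i + 1)) (p (i + 1))) = c)" for i
      using height_along[of i] fold_exit[of i] by simp
  qed (simp add: c_def)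
  define g where "g v = height (image_on_circle v) - c" for v

  have balance: "(1 - a i) * g (vert (t i) (nxt (l i))) + a i * g (vert (t i) (prv (l i))) = 0" for i
    using height_const[of i] unfolding fold_entry comb_on_side
    by (simp add: height_def g_def algebra_simps)
  \<comment> \<open>Midpoints of the segments are interior points, so unlike crossing points they
    determine their cell.\<close>
  obtain \<beta> where \<beta>: "\<And>i k. \<beta> i k > 0" "\<And>i. \<beta> i A + \<beta> i B + \<beta> i C = 1"
    and mid: "\<And>i. midpoint (p i) (p (i + 1)) = comb (realize (t i)) (\<beta> i)"
    and mid_in: "\<And>i. midpoint (p i) (p (i + 1)) \<in> tile_interior (realize (t i))"
  proof -
    have mid: "midpoint (p i) (p (i + 1)) \<in> tile_interior (realize (t i))" for i
      using tr(2,3)[of i] by (auto simp: t midpoint_in_open_segment)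
    then have "\<exists>\<beta>. \<forall>i. (\<forall>k. \<beta> i k > 0) \<and> \<beta> i A + \<beta> i B + \<beta> i C = 1 \<and>
        midpoint (p i) (p (i + 1)) = comb (realize (t i)) (\<beta> i)"
      by (intro choice) (metis tile_interior_comb cross_realize_nonzero)
    then show thesis using that mid by blast
  qed
  have mid_height: "\<beta> i A * g (vert (t i) A) + \<beta> i B * g (vert (t i) B) + \<beta> i C * g (vert (t i) C) = 0" for i
  proof -
    have "height (fold_point (t i) (midpoint (p i) (p (i + 1)))) = c"
    proof -
      have "midpoint (p i) (p (i + 1)) = p i + (1 / 2) *\<^sub>R (p (i + 1) - p i)"
        by (simp add: midpoint_def scaleR_conv_of_real field_simps)
      then have "fold_point (t i) (midpoint (p i) (p (i + 1))) = fold_point (t i) (p i) +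
          (1 / 2) *\<^sub>R (fold_point (t i) (p (i + 1)) - fold_point (t i) (p i))"
        using fold_point_shift[of "t i" "p i" "1 / 2" "p (i + 1) - p i"]
          fold_point_shift[of "t i" "p i" 1 "p (i + 1) - p i"] by simp
      then show ?thesis
        using height_along[of i] height_const[of i] by (simp add: height_linear)
    qed
    then have "\<beta> i A * height (image_on_circle (vert (t i) A)) + \<beta> i B * height (image_on_circle (vert (t i) B)) +
        \<beta> i C * height (image_on_circle (vert (t i) C)) = (\<beta> i A + \<beta> i B + \<beta> i C) * c"
      unfolding mid fold_point_comb[OF \<beta>(2)] height_comb \<beta>(2) by simp
    then show ?thesis
      by (simp add: g_def algebra_simps)
  qed
  have crossed: "g (vert (t i) (nxt (l i))) * g (vert (t i) (prv (l i))) < 0" for i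
  proof -
    let ?x = "g (vert (t i) (nxt (l i)))" and ?y = "g (vert (t i) (prv (l i)))"
    \<comment> \<open>A zero at this end forces one at the other end, then, by the zero at the
      interior midpoint, at the third vertex: the folded tile would lie on a line.\<close>
    have "?y \<noteq> 0"
    proof
      assume y: "?y = 0"
      then have x: "?x = 0"
        using balance[of i] a(2)[of i] by simp
      have "\<beta> i (l i) * g (vert (t i) (l i)) = 0"
        using mid_height[of i] x y by (cases "l i") simp_all
      then have "g (vert (t i) (l i)) = 0"
        using \<beta>(1)[of i "l i"] by simp
      then have "g (vert (t i) k) = 0" for k
        using x y by (rule side_cases3[of "\<lambda>k. g (vert (t i) k) = 0"])
      then show False
        using image_not_on_line[of \<kappa> "t i" c] \<open>\<kappa> \<noteq> 0\<close> by (auto simp: g_def height_def)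
    qed
    have "(1 - a i) * (?x * ?y) = - (a i * ?y\<^sup>2)"
      using arg_cong[OF balance[of i], of "\<lambda>z. z * ?y"] by (simp add: algebra_simps power2_eq_square)
    also have "\<dots> < 0"
      using a(1)[of i] \<open>?y \<noteq> 0\<close> by simp
    finally show ?thesis
      using a(2)[of i] by (simp add: mult_less_0_iff)
  qed
  have turn: "l (i + 1) \<noteq> l i" for i
  proof
    assume eq: "l (i + 1) = l i"
    define b where "b = (a i + (1 - a (i + 1))) / 2"
    have "midpoint (p i) (p (i + 1)) = comb (realize (t i)) (on_side (l i) b)"
      unfolding a(3)[of i] p_exit[of i] eq comb_on_side midpoint_def b_def
      by (simp add: scaleR_conv_of_real field_simps)
    then have "\<beta> i (l i) = on_side (l i) b (l i)"
      using comb_unique[OF cross_realize_nonzero, of "t i" "\<beta> i"] mid \<beta>(2) on_side_sum by metis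
    then show False
      using \<beta>(1)[of i "l i"] by simp
  qed

  have cells_of_closing: "t (i + int N) = t i" if "closes_after \<delta> N" for N i
  proof -
    have "p (i + int N) = p i" for i
      using that by (simp add: closes_after_def p_def)
    from this[of i] this[of "i + 1"]
    have "midpoint (p (i + int N)) (p (i + int N + 1)) = midpoint (p i) (p (i + 1))"
      by (simp add: ac_simps)
    then show ?thesis
      using interiors_disjoint mid_in by metis
  qed
  have coding_of_closing: "l (i + int N) = l i" if "closes_after \<delta> N" for N i
  proof -
    have "flip (t (i - 1)) (l (i + int N)) = flip (t (i - 1)) (l i)"
      using cells_of_closing[OF that, of "i - 1"] cells_of_closing[OF that, of i]
        step[of "i - 1"] step[of "i - 1 + int N"] by (simp add: ac_simps)
    then show ?thesis by (rule flip_inj)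
  qed
  obtain N where N: "closes_after \<delta> N"
    using closed unfolding closed_trajectory_def by blast
  then have "N > 0" by (simp add: closes_after_def)
  have "t i \<in> t ` {0..<int N}" for i
  proof (rule image_eqI)
    show "t i = t (i mod int N)"
      using int_periodic_mod[of t "int N" i] cells_of_closing[OF N] by simp
    show "i mod int N \<in> {0..<int N}"
      using \<open>N > 0\<close> by simp
  qed
  then have "finite (range t)"
    by (intro finite_subset[of "range t" "t ` {0..<int N}"]) auto
  then interpret contour t l g
    using step turn crossed by unfold_locales

  \<comment> \<open>The factor \<open>- \<i>\<close> turns the imaginary part in
    \<open>height\<close> into a real part, and \<open>r\<close> scales to the unit circle.\<close>
  define X where "X v = - \<i> * cnj \<kappa> * image_on_circle v / r" for v
  have norm_X: "cmod (X v) = 1" for v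
    using \<kappa> r_pos on_circle by (simp add: X_def image_on_circle_def norm_mult norm_divide norm_character U_def)
  have mult_X: "X (u + v - w) * X w = X u * X v" for u v w
    by (simp add: X_def image_on_circle_def character_add character_diff field_simps)
  have g_X: "g v = r * Re (X v) - c" for v
    using r_pos by (simp add: g_def height_def X_def)
  have "\<exists>j. odd j \<and> (\<forall>i. l (i + j) = l i)"
  proof (rule odd_coding_period)
    fix v assume "0 < g v" "finite (component g v)"
    then show "centrally_symmetric (component g v)"
      using circle_component_symmetric[of X, OF norm_X mult_X g_X r_pos] by blast
  next
    fix v assume v: "g v < 0" "finite (component (\<lambda>v. - g v) v)"
    show "centrally_symmetric (component (\<lambda>v. - g v) v)"
    \<comment> \<open>Negation turns the circle by half a turn and so centres the complementary arc
      at 1.\<close>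
    proof (rule circle_component_symmetric[of "\<lambda>v. - X v"])
      show "- g u = r * Re (- X u) - (- c)" for u
        by (simp add: g_X)
    qed (use v norm_X mult_X r_pos in simp_all)
  qed
  then obtain j where j: "odd j" "\<And>i. l (i + j) = l i"
    by blast
  define m where "m = length (minimal_period l)"
  note period = minimal_period_dvd[of N l, OF \<open>N > 0\<close> coding_of_closing[OF N], folded m_def]
  have "odd m"
    using period(3)[OF j(2)] j(1) by (metis dvd_trans even_of_nat)
  have "m \<noteq> 1"
    using period(2)[of 0] turn[of 0] by auto
  have cells_2m: "t (i + int (2 * m)) = t i" for i
    using cell_period[of "int m"] period(2) \<open>odd m\<close> by simp
  have codes_2m: "l (i + int (2 * m)) = l i" for i
    using period(2)[of i] period(2)[of "i + int m"] by (simp add: ac_simps)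
  have "closes_after \<delta> (2 * m)"
    unfolding closes_after_def
  proof (intro conjI allI)
    show "2 * m > 0" using period(1) by simp
    fix i
    let ?i = "i + int (2 * m)"
    let ?x = "g (vert (t i) (nxt (l i)))" and ?y = "g (vert (t i) (prv (l i)))"
    have "(1 - a ?i) * ?x + a ?i * ?y = 0"
      using balance[of ?i] unfolding cells_2m codes_2m .
    \<comment> \<open>On a crossed side \<open>g\<close> is affine and not constant, so its zero,
      the crossing point, is unique.\<close>
    then have "(a ?i - a i) * (?y - ?x) = 0"
      using balance[of i] by (simp add: algebra_simps)
    moreover have "?y \<noteq> ?x"
      using crossed[of i] by (auto simp: not_less)
    ultimately have "a ?i = a i" by simp
    then have "p ?i = p i"
      unfolding a(3) cells_2m codes_2m by simp
    then show "point \<delta> ?i = point \<delta> i"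
      by (simp add: p_def)
  qed
  \<comment> \<open>The coding makes \<open>M\<close> a multiple of \<open>m\<close>, the
    alternating orientations make it even, and \<open>m\<close> is odd.\<close>
  moreover have "2 * m \<le> M" if "closes_after \<delta> M" for M
  proof -
    have "m dvd M"
      using period(3)[of "int M"] coding_of_closing[OF that] by simp
    moreover have "even M"
      using parity[of "int M"] cells_of_closing[OF that, of 0] by simp argo
    ultimately have "2 * m dvd M"
      using \<open>odd m\<close> by (intro divides_mult) simp_all
    then show ?thesis
      using that by (auto simp: closes_after_def intro: dvd_imp_le)
  qed
  ultimately have "period \<delta> = 2 * m"
    unfolding period_def by (rule Least_equality)
  moreover obtain n where n: "m = 2 * n + 1"
    using \<open>odd m\<close> by (rule oddE)
  moreover have "n \<ge> 1"
    using n \<open>m \<noteq> 1\<close> by simp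
  ultimately show ?thesis
    using \<open>odd m\<close> unfolding m_def l_def by auto
qed

end

theorem proposition14:
  fixes \<Delta> :: triangle and \<delta> :: path
  assumes "\<not> collinear (range \<Delta>)"
    and "trajectory \<Delta> \<delta>"
    and "closed_trajectory \<delta>"
  shows "odd (length (minimal_period (coding \<delta>))) \<and>
         (\<exists>n::nat. n \<ge> 1 \<and> period \<delta> = 4 * n + 2)"
proof -
  have "cross \<Delta> \<noteq> 0"
    using assms(1) collinear_range_iff by blast
  then obtain P r where "r > 0" "\<And>k. cmod (\<Delta> k - P) = r"
    using circumcircle by blast
  then interpret developed_tiling \<Delta> P r
    using \<open>cross \<Delta> \<noteq> 0\<close> by unfold_locales
  show ?thesis
    using assms(2,3) by (rule period_of_closed_trajectory)
qed

end
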